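(* Suppose the underlying classical logic is undecidable, i.e., there is no algorithm deciding, for a given sentence $\psi$, whether $\vdash\psi$. Then no weighing $\mathcal{W}$ that satisfies both HP and EP is computable.
   Context: The underlying logic is classical (propositional or first-order) logic over a fixed countable, effectively presented language, with the usual effective notion of proof (so the set of provable sentences is recursively enumerable, and negation is a computable operation on sentences). A theory is a set of sentences. $T\vdash U$ means $T$ proves every sentence in $U$; $T\equiv U$ means $T\vdash U$ and $U\vdash T$. A weighing is a mapping $\mathcal{W}$ from theories to real numbers. It satisfies HP if for all theories $T,U$, $\mathcal{W}(U)>\mathcal{W}(T)$ implies $T\nvdash U$. It satisfies EP if for all theories $T,U$, $\mathcal{W}(T)=\mathcal{W}(U)$ implies $T\equiv U$. A weighing is computable if its values on finite theories are computable uniformly from the theory: there is an algorithm which, given a finite theory $T$ and $k\in\mathbb{N}$, outputs a rational number within $2^{-k}$ of $\mathcal{W}(T)$. *)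

theory Defs
  imports Complex_Main "HOL-Library.Nat_Bijection" "HOL-Library.Countable"
begin

section \<open>Algorithms: partial recursive functions\<close>

datatype recf =
    Zero
  | Succ
  | Proj nat
  | Comp recf "recf list"
  | PrimRec recf recf
  | Mu recf

text \<open>\<open>eval e xs y\<close>: the program \<open>e\<close> halts on the input tuple \<open>xs\<close> with output \<open>y\<close>.
  Arities are implicit; a program undefined on tuples of a given length simply has no value there.\<close>

inductive eval :: "recf \<Rightarrow> nat list \<Rightarrow> nat \<Rightarrow> bool" where
  Zero: "eval Zero xs 0"
| Succ: "eval Succ [x] (Suc x)"
| Proj: "i < length xs \<Longrightarrow> eval (Proj i) xs (xs ! i)"
| Comp: "list_all2 (\<lambda>g y. eval g xs y) gs ys \<Longrightarrow> eval f ys z \<Longrightarrow> eval (Comp f gs) xs z"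
| PrimRec_0: "eval f xs y \<Longrightarrow> eval (PrimRec f g) (0 # xs) y"
| PrimRec_Suc: "eval (PrimRec f g) (n # xs) y \<Longrightarrow> eval g (n # y # xs) z
    \<Longrightarrow> eval (PrimRec f g) (Suc n # xs) z"
| Mu: "eval f (n # xs) 0 \<Longrightarrow> (\<forall>i<n. \<exists>y. eval f (i # xs) (Suc y)) \<Longrightarrow> eval (Mu f) xs n"

lemma eval_deterministic:
  assumes "eval e xs y" and "eval e xs z"
  shows "y = z"
  using assms
proof (induction arbitrary: z rule: eval.induct)
  case (Comp xs gs ys f y)
  from Comp.prems obtain zs where zs: "list_all2 (\<lambda>g y. eval g xs y) gs zs" "eval f zs z"
    by cases auto
  have "ys = zs"
    using Comp.IH(1) zs(1) by (auto simp: list_all2_conv_all_nth intro!: nth_equalityI)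
  then show ?case
    using Comp.IH(2) zs(2) by simp
next
  case (PrimRec_Suc f g n xs y y')
  from PrimRec_Suc.prems obtain u where "eval (PrimRec f g) (n # xs) u" "eval g (n # u # xs) z"
    by cases auto
  then show ?case
    using PrimRec_Suc.IH by blast
next
  case (Mu f n xs)
  from Mu.prems have z: "eval f (z # xs) 0" "\<forall>i<z. \<exists>y. eval f (i # xs) (Suc y)"
    by (cases; blast)+
  have "\<not> z < n" "\<not> n < z"
    using Mu.IH z by blast+
  then show ?case
    by simp
qed (erule eval.cases; simp)+

definition decidable_on :: "('a \<Rightarrow> nat) \<Rightarrow> 'a set \<Rightarrow> ('a \<Rightarrow> bool) \<Rightarrow> bool" where
  "decidable_on code D P \<longleftrightarrow> (\<exists>e. \<forall>x\<in>D. eval e [code x] (if P x then 1 else 0))"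


section \<open>Classical propositional and first-order logic\<close>

datatype tm = Var nat | Fn nat "tm list"

datatype fm =
    Bot
  | Pre nat "tm list"
  | Eql tm tm
  | Imp fm fm
  | Forall nat fm

abbreviation Neg :: "fm \<Rightarrow> fm" where
  "Neg \<phi> \<equiv> Imp \<phi> Bot"

text \<open>\<open>Propositional A\<close> is the propositional language with letters \<open>A\<close>.  \<open>FirstOrder F P e\<close> is the
  first-order language with function symbols \<open>F\<close> and predicate symbols \<open>P\<close>, a symbol being a pair
  of a name and an arity (constants are function symbols of arity 0); \<open>e\<close> says whether equality is
  present as a logical symbol.\<close>

datatype language =
    Propositional "nat set"
  | FirstOrder "(nat \<times> nat) set" "(nat \<times> nat) set" bool

fun effectively_presented :: "language \<Rightarrow> bool" where
  "effectively_presented (Propositional A) \<longleftrightarrow> decidable_on id UNIV (\<lambda>p. p \<in> A)"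
| "effectively_presented (FirstOrder F P e) \<longleftrightarrow>
     decidable_on prod_encode UNIV (\<lambda>s. s \<in> F) \<and> decidable_on prod_encode UNIV (\<lambda>s. s \<in> P)"

fun is_term :: "(nat \<times> nat) set \<Rightarrow> tm \<Rightarrow> bool" where
  "is_term F (Var x) \<longleftrightarrow> True"
| "is_term F (Fn f ts) \<longleftrightarrow> (f, length ts) \<in> F \<and> (\<forall>t\<in>set ts. is_term F t)"

fun is_formula :: "language \<Rightarrow> fm \<Rightarrow> bool" where
  "is_formula L Bot \<longleftrightarrow> True"
| "is_formula L (Pre p ts) \<longleftrightarrow>
     (case L of
        Propositional A \<Rightarrow> p \<in> A \<and> ts = []
      | FirstOrder F P e \<Rightarrow> (p, length ts) \<in> P \<and> (\<forall>t\<in>set ts. is_term F t))"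
| "is_formula L (Eql s t) \<longleftrightarrow>
     (case L of
        Propositional A \<Rightarrow> False
      | FirstOrder F P e \<Rightarrow> e \<and> is_term F s \<and> is_term F t)"
| "is_formula L (Imp \<phi> \<psi>) \<longleftrightarrow> is_formula L \<phi> \<and> is_formula L \<psi>"
| "is_formula L (Forall x \<phi>) \<longleftrightarrow>
     (case L of
        Propositional A \<Rightarrow> False
      | FirstOrder F P e \<Rightarrow> is_formula L \<phi>)"

fun fv_tm :: "tm \<Rightarrow> nat set" where
  "fv_tm (Var x) = {x}"
| "fv_tm (Fn f ts) = (\<Union>t\<in>set ts. fv_tm t)"

fun fv :: "fm \<Rightarrow> nat set" where
  "fv Bot = {}"
| "fv (Pre p ts) = (\<Union>t\<in>set ts. fv_tm t)"
| "fv (Eql s t) = fv_tm s \<union> fv_tm t"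
| "fv (Imp \<phi> \<psi>) = fv \<phi> \<union> fv \<psi>"
| "fv (Forall x \<phi>) = fv \<phi> - {x}"

definition sentences :: "language \<Rightarrow> fm set" where
  "sentences L = {\<phi>. is_formula L \<phi> \<and> fv \<phi> = {}}"

fun subst_tm :: "nat \<Rightarrow> tm \<Rightarrow> tm \<Rightarrow> tm" where
  "subst_tm x s (Var y) = (if y = x then s else Var y)"
| "subst_tm x s (Fn f ts) = Fn f (map (subst_tm x s) ts)"

text \<open>\<open>subst x s \<phi>\<close> replaces the free occurrences of \<open>x\<close> in \<open>\<phi>\<close> by \<open>s\<close> without renaming bound
  variables; it is only used when \<open>s\<close> is free for \<open>x\<close> in \<open>\<phi>\<close>.\<close>

fun subst :: "nat \<Rightarrow> tm \<Rightarrow> fm \<Rightarrow> fm" where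
  "subst x s Bot = Bot"
| "subst x s (Pre p ts) = Pre p (map (subst_tm x s) ts)"
| "subst x s (Eql t u) = Eql (subst_tm x s t) (subst_tm x s u)"
| "subst x s (Imp \<phi> \<psi>) = Imp (subst x s \<phi>) (subst x s \<psi>)"
| "subst x s (Forall y \<phi>) = (if y = x then Forall y \<phi> else Forall y (subst x s \<phi>))"

fun free_for :: "tm \<Rightarrow> nat \<Rightarrow> fm \<Rightarrow> bool" where
  "free_for s x (Imp \<phi> \<psi>) \<longleftrightarrow> free_for s x \<phi> \<and> free_for s x \<psi>"
| "free_for s x (Forall y \<phi>) \<longleftrightarrow> x \<notin> fv (Forall y \<phi>) \<or> (y \<notin> fv_tm s \<and> free_for s x \<phi>)"
| "free_for s x _ \<longleftrightarrow> True"

text \<open>A Hilbert calculus.  All axiom instances are formulas of the language, so in a propositional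
  language only \<open>hyp\<close>, \<open>K\<close>, \<open>S\<close>, \<open>DN\<close> and \<open>MP\<close> apply, and the equality axioms are available only
  in languages with equality.  Hypotheses are meant to be sentences, hence generalization is
  unrestricted.\<close>

inductive derives :: "language \<Rightarrow> fm set \<Rightarrow> fm \<Rightarrow> bool" for L :: language and T :: "fm set" where
  hyp: "\<phi> \<in> T \<Longrightarrow> derives L T \<phi>"
| K: "is_formula L \<phi> \<Longrightarrow> is_formula L \<psi> \<Longrightarrow> derives L T (Imp \<phi> (Imp \<psi> \<phi>))"
| S: "is_formula L \<phi> \<Longrightarrow> is_formula L \<psi> \<Longrightarrow> is_formula L \<chi> \<Longrightarrow>
    derives L T (Imp (Imp \<phi> (Imp \<psi> \<chi>)) (Imp (Imp \<phi> \<psi>) (Imp \<phi> \<chi>)))"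
| DN: "is_formula L \<phi> \<Longrightarrow> derives L T (Imp (Neg (Neg \<phi>)) \<phi>)"
| Inst: "is_formula L (Imp (Forall x \<phi>) (subst x t \<phi>)) \<Longrightarrow> free_for t x \<phi> \<Longrightarrow>
    derives L T (Imp (Forall x \<phi>) (subst x t \<phi>))"
| Distr: "is_formula L (Forall x (Imp \<phi> \<psi>)) \<Longrightarrow> x \<notin> fv \<phi> \<Longrightarrow>
    derives L T (Imp (Forall x (Imp \<phi> \<psi>)) (Imp \<phi> (Forall x \<psi>)))"
| Refl: "is_formula L (Eql t t) \<Longrightarrow> derives L T (Eql t t)"
| Leibniz: "is_formula L (Eql s t) \<Longrightarrow> is_formula L \<phi> \<Longrightarrow> free_for s x \<phi> \<Longrightarrow> free_for t x \<phi> \<Longrightarrow>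
    derives L T (Imp (Eql s t) (Imp (subst x s \<phi>) (subst x t \<phi>)))"
| MP: "derives L T (Imp \<phi> \<psi>) \<Longrightarrow> derives L T \<phi> \<Longrightarrow> derives L T \<psi>"
| Gen: "derives L T \<phi> \<Longrightarrow> is_formula L (Forall x \<phi>) \<Longrightarrow> derives L T (Forall x \<phi>)"

fun tm_code :: "tm \<Rightarrow> nat" where
  "tm_code (Var x) = prod_encode (0, x)"
| "tm_code (Fn f ts) = prod_encode (1, prod_encode (f, list_encode (map tm_code ts)))"

fun fm_code :: "fm \<Rightarrow> nat" where
  "fm_code Bot = prod_encode (0, 0)"
| "fm_code (Pre p ts) = prod_encode (1, prod_encode (p, list_encode (map tm_code ts)))"
| "fm_code (Eql s t) = prod_encode (2, prod_encode (tm_code s, tm_code t))"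
| "fm_code (Imp \<phi> \<psi>) = prod_encode (3, prod_encode (fm_code \<phi>, fm_code \<psi>))"
| "fm_code (Forall x \<phi>) = prod_encode (4, prod_encode (x, fm_code \<phi>))"

lemma inj_tm_code: "inj tm_code"
proof (rule injI)
  show "s = t" if "tm_code s = tm_code t" for s t
    using that
  proof (induction s arbitrary: t)
    case (Var x)
    then show ?case by (cases t) auto
  next
    case (Fn f ts)
    then obtain us where t: "t = Fn f us" and "map tm_code ts = map tm_code us"
      by (cases t) (auto simp: list_encode_eq)
    then have "ts = us"
      using Fn.IH by (metis (no_types, lifting) list.inj_map_strong)
    then show ?case using t by simp
  qed
qed

lemma inj_fm_code: "inj fm_code"
proof (rule injI)
  show "\<phi> = \<psi>" if "fm_code \<phi> = fm_code \<psi>" for \<phi> \<psi>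
    using that
  proof (induction \<phi> arbitrary: \<psi>)
    case Bot
    then show ?case by (cases \<psi>) auto
  next
    case (Pre p ts)
    then show ?case
      by (cases \<psi>) (auto simp: list_encode_eq inj_tm_code inj_map_eq_map)
  next
    case (Eql s t)
    then show ?case by (cases \<psi>) (auto simp: inj_eq[OF inj_tm_code])
  next
    case (Imp \<phi>1 \<phi>2)
    then show ?case by (cases \<psi>) auto
  next
    case (Forall x \<phi>)
    then show ?case by (cases \<psi>) auto
  qed
qed

definition decidable_logic :: "language \<Rightarrow> bool" where
  "decidable_logic L \<longleftrightarrow> decidable_on fm_code (sentences L) (\<lambda>\<psi>. derives L {} \<psi>)"


section \<open>Theories and weighings\<close>

definition theory_of :: "language \<Rightarrow> fm set \<Rightarrow> bool" where
  "theory_of L T \<longleftrightarrow> T \<subseteq> sentences L"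

definition proves :: "language \<Rightarrow> fm set \<Rightarrow> fm set \<Rightarrow> bool" where
  "proves L T U \<longleftrightarrow> (\<forall>\<phi>\<in>U. derives L T \<phi>)"

definition equivalent :: "language \<Rightarrow> fm set \<Rightarrow> fm set \<Rightarrow> bool" where
  "equivalent L T U \<longleftrightarrow> proves L T U \<and> proves L U T"

text \<open>A weighing is a function \<open>fm set \<Rightarrow> real\<close>; only its values on theories of \<open>L\<close> matter.\<close>

definition HP :: "language \<Rightarrow> (fm set \<Rightarrow> real) \<Rightarrow> bool" where
  "HP L W \<longleftrightarrow> (\<forall>T U. theory_of L T \<longrightarrow> theory_of L U \<longrightarrow> W U > W T \<longrightarrow> \<not> proves L T U)"

definition EP :: "language \<Rightarrow> (fm set \<Rightarrow> real) \<Rightarrow> bool" where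
  "EP L W \<longleftrightarrow> (\<forall>T U. theory_of L T \<longrightarrow> theory_of L U \<longrightarrow> W T = W U \<longrightarrow> equivalent L T U)"

text \<open>A finite theory is given to an algorithm by the canonical index of its set of codes, and
  the output \<open>q\<close> is a code of the rational \<open>nat_to_rat_surj q\<close>.\<close>

definition computable_weighing :: "language \<Rightarrow> (fm set \<Rightarrow> real) \<Rightarrow> bool" where
  "computable_weighing L W \<longleftrightarrow>
     (\<exists>e. \<forall>T k. theory_of L T \<longrightarrow> finite T \<longrightarrow>
        (\<exists>q. eval e [set_encode (fm_code ` T), k] q \<and>
             \<bar>of_rat (nat_to_rat_surj q) - W T\<bar> \<le> 1 / 2 ^ k))"

end

theory Submission
  imports Defs
begin

text \<open>Theories are equivalent iff they have the same weight, so a sentence \<open>\<psi>\<close> is provable iff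
  \<open>W {\<psi>} = W {}\<close>.  If \<open>W\<close> is computable, unprovability is semidecidable: wait until approximations
  separate the two real numbers.  Provability is semidecidable because it is part of an inductive
  definition whose rules refer to finitely many premises and are decidable.  By Post's theorem
  provability is then decidable.\<close>

section \<open>Programs\<close>

lemma eval_Comp1:
  "eval g xs a \<Longrightarrow> eval f [a] z \<Longrightarrow> eval (Comp f [g]) xs z"
  by (rule eval.Comp[where ys = "[a]"]) auto

lemma eval_Comp2:
  "eval g xs a \<Longrightarrow> eval h xs b \<Longrightarrow> eval f [a, b] z \<Longrightarrow> eval (Comp f [g, h]) xs z"
  by (rule eval.Comp[where ys = "[a, b]"]) auto

lemma eval_Proj_nth: "i < length xs \<Longrightarrow> y = xs ! i \<Longrightarrow> eval (Proj i) xs y"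
  by (auto intro: eval.Proj)

lemma eval_PrimRec_rec_nat:
  fixes code :: "'a \<Rightarrow> nat"
  assumes "eval f xs (code a)" "\<And>i r. eval g (i # code r # xs) (code (b i r))"
  shows "eval (PrimRec f g) (n # xs) (code (rec_nat a b n))"
  by (induction n) (auto intro: eval.PrimRec_0 eval.PrimRec_Suc assms)

lemmas eval_PrimRec_nat = eval_PrimRec_rec_nat[where code = "\<lambda>n. n"]

lemma eval_Mu_Least:
  assumes f: "\<And>i. eval f (i # xs) (g i)" and zero: "\<exists>i. g i = 0"
  shows "eval (Mu f) xs (LEAST i. g i = 0)"
proof (rule eval.Mu)
  show "eval f ((LEAST i. g i = 0) # xs) 0"
    using f zero LeastI_ex[of "\<lambda>i. g i = 0"] by metis
  show "\<forall>i<LEAST i. g i = 0. \<exists>y. eval f (i # xs) (Suc y)"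
    using f not_less_Least[of _ "\<lambda>i. g i = 0"] by (metis not0_implies_Suc)
qed

lemma ex_eval_const: "\<exists>e. \<forall>xs. eval e xs c"
proof (induction c)
  case 0
  then show ?case by (blast intro: eval.Zero)
next
  case (Suc c)
  then show ?case by (blast intro: eval_Comp1 eval.Succ)
qed


section \<open>Computable functions between encodable types\<close>

class encodable =
  fixes encode :: "'a \<Rightarrow> nat"
  assumes inj_encode: "inj encode"
begin

lemma encode_eq_iff [simp]: "encode x = encode y \<longleftrightarrow> x = y"
  by (simp add: inj_eq[OF inj_encode])

end

instantiation nat :: encodable
begin

definition [simp]: "encode (n :: nat) = n"

instance by standard (simp add: inj_def)

end

instantiation bool :: encodable
begin

definition [simp]: "encode b = (of_bool b :: nat)"

instance by standard (simp add: inj_def)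

end

instantiation int :: encodable
begin

definition [simp]: "encode = int_encode"

instance by standard (simp add: inj_int_encode)

end

instantiation prod :: (encodable, encodable) encodable
begin

definition [simp]: "encode p = prod_encode (encode (fst p), encode (snd p))"

instance by standard (simp add: inj_def prod_eq_iff)

end

instantiation list :: (encodable) encodable
begin

definition "encode xs = list_encode (map encode xs)"

instance
  by standard (simp add: inj_def encode_list_def list_encode_eq inj_map_eq_map[OF inj_encode])

end

lemma encode_Nil [simp]: "encode [] = 0"
  by (simp add: encode_list_def)

lemma encode_Cons [simp]: "encode (x # xs) = Suc (prod_encode (encode x, encode xs))"
  by (simp add: encode_list_def)

definition computable_on :: "'a::encodable set \<Rightarrow> ('a \<Rightarrow> 'b::encodable) \<Rightarrow> bool" where
  "computable_on D f \<longleftrightarrow> (\<exists>e. \<forall>x\<in>D. eval e [encode x] (encode (f x)))"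

abbreviation computable :: "('a::encodable \<Rightarrow> 'b::encodable) \<Rightarrow> bool" where
  "computable \<equiv> computable_on UNIV"

definition computable2 :: "('a::encodable \<Rightarrow> 'b::encodable \<Rightarrow> 'c::encodable) \<Rightarrow> bool" where
  "computable2 h \<longleftrightarrow> (\<exists>e. \<forall>x y. eval e [encode x, encode y] (encode (h x y)))"

lemma computable_onI: "(\<And>x. x \<in> D \<Longrightarrow> eval e [encode x] (encode (f x))) \<Longrightarrow> computable_on D f"
  unfolding computable_on_def by blast

lemma computable2I: "(\<And>x y. eval e [encode x, encode y] (encode (h x y))) \<Longrightarrow> computable2 h"
  unfolding computable2_def by blast

lemma decidable_on_iff_computable_on: "decidable_on encode D P \<longleftrightarrow> computable_on D P"
  by (simp add: decidable_on_def computable_on_def of_bool_def)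

lemma computable_on_encode_cong:
  assumes "\<And>x. x \<in> D \<Longrightarrow> encode (f x) = encode (g x)"
  shows "computable_on D f \<longleftrightarrow> computable_on D g"
  by (simp add: computable_on_def assms)

lemma computable_on_compose:
  assumes "computable_on E g" "computable_on D f" "f ` D \<subseteq> E"
  shows "computable_on D (\<lambda>x. g (f x))"
  using assms unfolding computable_on_def by (meson eval_Comp1 image_subset_iff)

lemmas computable_on_unary = computable_on_compose[where E = UNIV, simplified]

lemma computable_on_binary:
  "computable2 h \<Longrightarrow> computable_on D f \<Longrightarrow> computable_on D g \<Longrightarrow>
    computable_on D (\<lambda>x. h (f x) (g x))"
  unfolding computable_on_def computable2_def by (meson eval_Comp2)

named_theorems computable_intros

lemma computable_on_const [computable_intros]: "computable_on D (\<lambda>_. c)"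
  using ex_eval_const[of "encode c"] unfolding computable_on_def by blast

lemma computable_on_ident [computable_intros]: "computable_on D (\<lambda>x. x)"
  by (rule computable_onI[of _ "Proj 0"]) (simp add: eval_Proj_nth)

lemma computable_on_encode [computable_intros]:
  "computable_on D f \<Longrightarrow> computable_on D (\<lambda>x. encode (f x))"
  by (simp add: computable_on_def)

lemma computable_on_if_encode: "computable_on D (\<lambda>x. encode (f x)) \<Longrightarrow> computable_on D f"
  by (simp add: computable_on_def)


subsection \<open>Pairing\<close>

lemma computable2_plus: "computable2 ((+) :: nat \<Rightarrow> nat \<Rightarrow> nat)"
proof (rule computable2I)
  fix x y :: nat
  let ?plus = "PrimRec (Proj 0) (Comp Succ [Proj 1])"
  have "rec_nat y (\<lambda>_. Suc) x = x + y" by (induction x) auto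
  moreover have "eval ?plus [x, y] (rec_nat y (\<lambda>_. Suc) x)"
    by (intro eval_PrimRec_nat eval_Comp1[OF eval_Proj_nth eval.Succ] eval_Proj_nth) auto
  ultimately show "eval ?plus [encode x, encode y] (encode (x + y))" by simp
qed

lemma computable_pred: "computable (\<lambda>n :: nat. n - 1)"
proof (rule computable_onI)
  fix n :: nat
  have "rec_nat 0 (\<lambda>i _. i) n = n - 1" by (cases n) auto
  moreover have "eval (PrimRec Zero (Proj 0)) [n] (rec_nat 0 (\<lambda>i _. i) n)"
    by (intro eval_PrimRec_nat eval_Proj_nth eval.Zero) auto
  ultimately show "eval (PrimRec Zero (Proj 0)) [encode n] (encode (n - 1))" by simp
qed

lemma computable2_minus: "computable2 ((-) :: nat \<Rightarrow> nat \<Rightarrow> nat)"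
proof -
  obtain pred where pred: "\<And>n :: nat. eval pred [n] (n - 1)"
    using computable_pred unfolding computable_on_def by auto
  let ?minus = "Comp (PrimRec (Proj 0) (Comp pred [Proj 1])) [Proj 1, Proj 0]"
  have "eval ?minus [x, y] (x - y)" for x y :: nat
  proof -
    have "rec_nat x (\<lambda>_ r. r - 1) y = x - y" by (induction y) auto
    moreover have "eval (PrimRec (Proj 0) (Comp pred [Proj 1])) [y, x] (rec_nat x (\<lambda>_ r. r - 1) y)"
      by (intro eval_PrimRec_nat eval_Comp1[OF eval_Proj_nth pred] eval_Proj_nth) auto
    ultimately show ?thesis by (auto intro!: eval_Comp2 eval_Proj_nth)
  qed
  then show ?thesis by (intro computable2I[of ?minus]) simp
qed

lemmas computable_on_plus [computable_intros] = computable_on_binary[OF computable2_plus]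
lemmas computable_on_minus [computable_intros] = computable_on_binary[OF computable2_minus]

lemma computable_on_Suc [computable_intros]:
  "computable_on D f \<Longrightarrow> computable_on D (\<lambda>x. Suc (f x))"
  using computable_on_plus[of D f "\<lambda>_. 1"] by (simp add: computable_on_const)

lemma computable_triangle: "computable triangle"
proof -
  obtain plus where plus: "\<And>x y :: nat. eval plus [x, y] (x + y)"
    using computable2_plus unfolding computable2_def by auto
  let ?step = "Comp Succ [Comp plus [Proj 0, Proj 1]]"
  have "eval (PrimRec Zero ?step) [n] (triangle n)" for n
  proof -
    have "rec_nat 0 (\<lambda>i r. Suc (i + r)) n = triangle n" by (induction n) auto
    moreover have "eval ?step [i, r] (Suc (i + r))" for i r
      by (rule eval_Comp1[OF eval_Comp2[OF _ _ plus] eval.Succ]) (auto intro: eval_Proj_nth)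
    ultimately show ?thesis
      using eval_PrimRec_nat[OF eval.Zero[of "[]"], of ?step "\<lambda>i r. Suc (i + r)" n] by simp
  qed
  then show ?thesis by (intro computable_onI[of _ "PrimRec Zero ?step"]) simp
qed

lemma computable2_Pair: "computable2 (Pair :: 'a::encodable \<Rightarrow> 'b::encodable \<Rightarrow> 'a \<times> 'b)"
proof -
  obtain plus where plus: "\<And>x y :: nat. eval plus [x, y] (x + y)"
    using computable2_plus unfolding computable2_def by auto
  obtain tri where tri: "\<And>n. eval tri [n] (triangle n)"
    using computable_triangle unfolding computable_on_def by auto
  have "eval (Comp plus [Comp tri [plus], Proj 0]) [m, n] (prod_encode (m, n))" for m n
    unfolding prod_encode_def prod.case
    by (rule eval_Comp2[OF eval_Comp1[OF plus tri] _ plus]) (auto intro: eval_Proj_nth)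
  then show ?thesis by (intro computable2I) simp
qed

lemma mono_triangle: "mono triangle"
  by (simp add: mono_iff_le_Suc)

lemma Least_triangle_prod_encode:
  "(LEAST s. Suc (prod_encode (m, n)) - triangle (Suc s) = 0) = m + n"
proof (rule Least_equality)
  show "Suc (prod_encode (m, n)) - triangle (Suc (m + n)) = 0" by (simp add: prod_encode_def)
  fix s
  assume "Suc (prod_encode (m, n)) - triangle (Suc s) = 0"
  then have "\<not> Suc s \<le> m + n"
    using monoD[OF mono_triangle, of "Suc s" "m + n"] by (auto simp: prod_encode_def)
  then show "m + n \<le> s" by simp
qed

lemma computable_sum_prod_decode: "computable (\<lambda>n. fst (prod_decode n) + snd (prod_decode n))"
proof -
  obtain minus where minus: "\<And>x y :: nat. eval minus [x, y] (x - y)"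
    using computable2_minus unfolding computable2_def by auto
  obtain tri where tri: "\<And>n. eval tri [n] (triangle n)"
    using computable_triangle unfolding computable_on_def by auto
  let ?gap = "Comp minus [Comp Succ [Proj 1], Comp tri [Comp Succ [Proj 0]]]"
  have "eval (Mu ?gap) [prod_encode (a, b)] (a + b)" for a b
  proof -
    have "eval ?gap [s, prod_encode (a, b)] (Suc (prod_encode (a, b)) - triangle (Suc s))" for s
      by (intro eval_Comp2[OF eval_Comp1[OF _ eval.Succ] _ minus]
          eval_Comp1[OF eval_Comp1[OF _ eval.Succ] tri]) (auto intro: eval_Proj_nth)
    moreover have "Suc (prod_encode (a, b)) - triangle (Suc (a + b)) = 0"
      by (simp add: prod_encode_def)
    ultimately show ?thesis
      unfolding Least_triangle_prod_encode[of a b, symmetric] by (intro eval_Mu_Least) blast+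
  qed
  from this[of "fst (prod_decode n)" "snd (prod_decode n)" for n]
  show ?thesis by (intro computable_onI[of _ "Mu ?gap"]) simp
qed

lemma computable_fst_prod_decode: "computable (\<lambda>n. fst (prod_decode n))"
proof -
  have "prod_encode (a, b) - triangle (a + b) = a" for a b
    by (simp add: prod_encode_def)
  from this[of "fst (prod_decode n)" "snd (prod_decode n)" for n]
  have "n - triangle (fst (prod_decode n) + snd (prod_decode n)) = fst (prod_decode n)" for n
    by simp
  moreover have "computable (\<lambda>n. n - triangle (fst (prod_decode n) + snd (prod_decode n)))"
    by (intro computable_intros computable_on_unary[OF computable_triangle]
        computable_sum_prod_decode)
  ultimately show ?thesis by simp
qed

lemma computable_snd_prod_decode: "computable (\<lambda>n. snd (prod_decode n))"
  using computable_on_minus[OF computable_sum_prod_decode computable_fst_prod_decode] by simp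

lemmas computable_on_Pair [computable_intros] = computable_on_binary[OF computable2_Pair]

lemma computable_on_fst [computable_intros]:
  assumes "computable_on D f"
  shows "computable_on D (\<lambda>x. fst (f x))"
proof -
  have "computable_on D (\<lambda>x. fst (prod_decode (encode (f x))))"
    by (intro computable_on_unary[OF computable_fst_prod_decode] computable_on_encode assms)
  then show ?thesis by (simp cong: computable_on_encode_cong)
qed

lemma computable_on_snd [computable_intros]:
  assumes "computable_on D f"
  shows "computable_on D (\<lambda>x. snd (f x))"
proof -
  have "computable_on D (\<lambda>x. snd (prod_decode (encode (f x))))"
    by (intro computable_on_unary[OF computable_snd_prod_decode] computable_on_encode assms)
  then show ?thesis by (simp cong: computable_on_encode_cong)
qed

lemma computable_on_Times_snd:
  "computable_on D f \<Longrightarrow> computable_on (E \<times> D) (\<lambda>p. f (snd p))"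
  by (rule computable_on_compose[OF _ computable_on_snd[OF computable_on_ident]]) auto

lemma computable_on_prod_encode [computable_intros]:
  "computable_on D f \<Longrightarrow> computable_on D (\<lambda>x. prod_encode (f x))"
  by (simp add: computable_on_def)

lemma computable_on_prod_decode [computable_intros]:
  "computable_on D f \<Longrightarrow> computable_on D (\<lambda>x. prod_decode (f x))"
  by (simp add: computable_on_def)

lemma computable_on_Cons [computable_intros]:
  assumes "computable_on D f" "computable_on D g"
  shows "computable_on D (\<lambda>x. f x # g x)"
  by (rule computable_on_if_encode, unfold encode_Cons) (intro computable_intros assms)



subsection \<open>Recursion and search\<close>

lemma computable_on_rec_nat:
  assumes "computable_on D a"
    and "computable_on (UNIV \<times> UNIV \<times> D) (\<lambda>p. b (fst p) (fst (snd p)) (snd (snd p)))"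
    and "computable_on D m"
  shows "computable_on D (\<lambda>x. rec_nat (a x) (\<lambda>i r. b i r x) (m x))"
proof -
  obtain base where base: "\<And>x. x \<in> D \<Longrightarrow> eval base [encode x] (encode (a x))"
    using assms(1) unfolding computable_on_def by blast
  obtain step where "\<forall>p\<in>UNIV \<times> UNIV \<times> D.
      eval step [encode p] (encode (b (fst p) (fst (snd p)) (snd (snd p))))"
    using assms(2) unfolding computable_on_def by blast
  then have step: "eval step [prod_encode (i, prod_encode (encode r, encode x))] (encode (b i r x))"
    if "x \<in> D" for i r x
    using that by (auto dest: bspec[where x = "(i, r, x)"])
  obtain bound where bound: "\<And>x. x \<in> D \<Longrightarrow> eval bound [encode x] (m x)"
    using assms(3) unfolding computable_on_def encode_nat_def by blast
  obtain pair where pair: "\<And>i j. eval pair [i, j] (prod_encode (i, j))"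
    using computable2_Pair[where 'a = nat and 'b = nat] unfolding computable2_def by auto
  let ?step = "Comp step [Comp pair [Proj 0, Comp pair [Proj 1, Proj 2]]]"
  have "eval ?step [i, encode r, encode x] (encode (b i r x))" if "x \<in> D" for i r x
    by (intro eval_Comp1[OF eval_Comp2[OF _ eval_Comp2[OF _ _ pair] pair] step[OF that]])
      (auto intro: eval_Proj_nth)
  then have "eval (PrimRec base ?step) [n, encode x] (encode (rec_nat (a x) (\<lambda>i r. b i r x) n))"
    if "x \<in> D" for n x
    using that by (intro eval_PrimRec_rec_nat[where code = encode] base)
  then show ?thesis
    by (intro computable_onI[of _ "Comp (PrimRec base ?step) [bound, Proj 0]"])
      (auto intro!: eval_Comp2[OF bound] eval_Proj_nth)
qed

lemma computable_on_mult [computable_intros]: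
  fixes f g :: "'a::encodable \<Rightarrow> nat"
  assumes "computable_on D f" "computable_on D g"
  shows "computable_on D (\<lambda>x. f x * g x)"
proof -
  have "computable (\<lambda>p :: nat \<times> nat. rec_nat 0 (\<lambda>_ r. r + snd p) (fst p))"
    by (rule computable_on_rec_nat; intro computable_intros)
  moreover have "rec_nat 0 (\<lambda>_ r. r + n) m = m * n" for m n :: nat by (induction m) auto
  ultimately show ?thesis
    using computable_on_unary[OF _ computable_on_Pair[OF assms], of "\<lambda>p. fst p * snd p"] by simp
qed

lemma computable_on_power [computable_intros]:
  fixes f g :: "'a::encodable \<Rightarrow> nat"
  assumes "computable_on D f" "computable_on D g"
  shows "computable_on D (\<lambda>x. f x ^ g x)"
proof -
  have "computable (\<lambda>p :: nat \<times> nat. rec_nat 1 (\<lambda>_ r. fst p * r) (snd p))"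
    by (rule computable_on_rec_nat; intro computable_intros)
  moreover have "rec_nat 1 (\<lambda>_ r. m * r) n = m ^ n" for m n :: nat by (induction n) auto
  ultimately show ?thesis
    using computable_on_unary[OF _ computable_on_Pair[OF assms], of "\<lambda>p. fst p ^ snd p"] by simp
qed

lemma computable_on_bool_iff: "computable_on D P \<longleftrightarrow> computable_on D (\<lambda>x. of_bool (P x) :: nat)"
  by (rule computable_on_encode_cong) simp

lemma computable_on_Not [computable_intros]:
  assumes "computable_on D P"
  shows "computable_on D (\<lambda>x. \<not> P x)"
proof -
  have "computable_on D (\<lambda>x. 1 - of_bool (P x) :: nat)"
    by (intro computable_intros assms[unfolded computable_on_bool_iff[of _ P]])
  moreover have "1 - of_bool b = (of_bool (\<not> b) :: nat)" for b by simp
  ultimately show ?thesis unfolding computable_on_bool_iff[of _ "\<lambda>x. \<not> P x"] by (simp only:)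
qed

lemma computable_on_conj [computable_intros]:
  assumes "computable_on D P" "computable_on D Q"
  shows "computable_on D (\<lambda>x. P x \<and> Q x)"
  unfolding computable_on_bool_iff[of _ "\<lambda>x. P x \<and> Q x"] of_bool_conj
  by (intro computable_intros assms[unfolded computable_on_bool_iff[of D]])

lemma computable_on_disj [computable_intros]:
  assumes "computable_on D P" "computable_on D Q"
  shows "computable_on D (\<lambda>x. P x \<or> Q x)"
  using computable_on_Not[OF computable_on_conj[OF assms[THEN computable_on_Not]]] by simp

lemma computable_on_imp [computable_intros]:
  assumes "computable_on D P" "computable_on D Q"
  shows "computable_on D (\<lambda>x. P x \<longrightarrow> Q x)"
  unfolding imp_conv_disj by (intro computable_intros assms)

lemma computable_on_le [computable_intros]:
  fixes f g :: "'a::encodable \<Rightarrow> nat"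
  assumes "computable_on D f" "computable_on D g"
  shows "computable_on D (\<lambda>x. f x \<le> g x)"
proof -
  have "computable_on D (\<lambda>x. 1 - (f x - g x))" by (intro computable_intros assms)
  moreover have "1 - (m - n) = (of_bool (m \<le> n) :: nat)" for m n :: nat by simp
  ultimately show ?thesis unfolding computable_on_bool_iff by (simp only:)
qed

lemma computable_on_less [computable_intros]:
  fixes f g :: "'a::encodable \<Rightarrow> nat"
  assumes "computable_on D f" "computable_on D g"
  shows "computable_on D (\<lambda>x. f x < g x)"
  unfolding not_le[symmetric] by (intro computable_intros assms)

lemma computable_on_eq [computable_intros]:
  assumes "computable_on D f" "computable_on D g"
  shows "computable_on D (\<lambda>x. f x = g x)"
proof -
  have "computable_on D (\<lambda>x. encode (f x) \<le> encode (g x) \<and> encode (g x) \<le> encode (f x))"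
    by (intro computable_intros assms)
  then show ?thesis by (simp add: order.eq_iff[symmetric])
qed

lemma computable_on_if [computable_intros]:
  assumes "computable_on D P" "computable_on D f" "computable_on D g"
  shows "computable_on D (\<lambda>x. if P x then f x else g x)"
proof -
  have "computable_on D (\<lambda>x. of_bool (P x) * encode (f x) + (1 - of_bool (P x)) * encode (g x))"
    by (intro computable_intros assms(2,3) assms(1)[unfolded computable_on_bool_iff])
  then show ?thesis by (rule computable_on_encode_cong[THEN iffD1, rotated]) simp
qed

lemma computable_on_Least:
  assumes "computable_on (UNIV \<times> D) (\<lambda>p. P (fst p) (snd p))"
    and ex: "\<And>x. x \<in> D \<Longrightarrow> \<exists>n :: nat. P n x"
  shows "computable_on D (\<lambda>x. LEAST n. P n x)"
proof -
  have "computable_on (UNIV \<times> D) (\<lambda>p. of_bool (\<not> P (fst p) (snd p)) :: nat)"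
    using computable_on_Not[OF assms(1)] by (simp only: computable_on_bool_iff)
  then obtain e where
    "\<forall>p\<in>UNIV \<times> D. eval e [encode p] (encode (of_bool (\<not> P (fst p) (snd p)) :: nat))"
    unfolding computable_on_def by blast
  then have e: "eval e [prod_encode (n, encode x)] (of_bool (\<not> P n x))" if "x \<in> D" for n x
    using that by (auto dest: bspec[where x = "(n, x)"])
  obtain pair where pair: "\<And>i j. eval pair [i, j] (prod_encode (i, j))"
    using computable2_Pair[where 'a = nat and 'b = nat] unfolding computable2_def by auto
  have "eval (Mu (Comp e [pair])) [encode x] (LEAST n. of_bool (\<not> P n x) = (0 :: nat))"
    if "x \<in> D" for x
    using ex[OF that] by (intro eval_Mu_Least eval_Comp1[OF pair e[OF that]]) simp
  then show ?thesis by (intro computable_onI[of _ "Mu (Comp e [pair])"]) simp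
qed

lemma computable_on_all_less:
  fixes f :: "'a::encodable \<Rightarrow> nat"
  assumes "computable_on (UNIV \<times> D) (\<lambda>p. P (fst p) (snd p))" "computable_on D f"
  shows "computable_on D (\<lambda>x. \<forall>i<f x. P i x)"
proof -
  have "computable_on (UNIV \<times> D) (\<lambda>p. fst p < f (snd p) \<longrightarrow> \<not> P (fst p) (snd p))"
    by (intro computable_intros assms computable_on_Times_snd[OF assms(2)])
  then have "computable_on D (\<lambda>x. LEAST i. i < f x \<longrightarrow> \<not> P i x)"
    by (rule computable_on_Least) (meson less_irrefl)
  then have "computable_on D (\<lambda>x. f x \<le> (LEAST i. i < f x \<longrightarrow> \<not> P i x))"
    by (intro computable_intros assms)
  moreover have "n \<le> (LEAST i. i < n \<longrightarrow> \<not> Q i) \<longleftrightarrow> (\<forall>i<n. Q i)" for n :: nat and Q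
  proof
    assume "n \<le> (LEAST i. i < n \<longrightarrow> \<not> Q i)"
    then show "\<forall>i<n. Q i" using not_less_Least order.strict_trans2 by blast
  next
    assume "\<forall>i<n. Q i"
    moreover have "(LEAST i. i < n \<longrightarrow> \<not> Q i) < n \<longrightarrow> \<not> Q (LEAST i. i < n \<longrightarrow> \<not> Q i)"
      by (rule LeastI[of _ n]) simp
    ultimately show "n \<le> (LEAST i. i < n \<longrightarrow> \<not> Q i)" by (meson not_le)
  qed
  ultimately show ?thesis by (simp only:)
qed

lemma computable_on_div [computable_intros]:
  fixes f g :: "'a::encodable \<Rightarrow> nat"
  assumes "computable_on D f" "computable_on D g"
  shows "computable_on D (\<lambda>x. f x div g x)"
proof -
  have less_mult_Suc_div: "n = 0 \<or> m < n * Suc (m div n)" for m n :: nat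
    by (metis dividend_less_times_div mult_Suc_right neq0_conv)
  have div_eq_Least: "m div n = (LEAST q. n = 0 \<or> m < n * Suc q)" for m n :: nat
  proof (rule Least_equality[symmetric])
    show "n = 0 \<or> m < n * Suc (m div n)" by (rule less_mult_Suc_div)
    show "m div n \<le> q" if "n = 0 \<or> m < n * Suc q" for q
      using that by (metis div_by_0 le0 less_Suc_eq_le less_mult_imp_div_less mult.commute)
  qed
  show ?thesis
    unfolding div_eq_Least
  proof (rule computable_on_Least)
    show "computable_on (UNIV \<times> D) (\<lambda>p. g (snd p) = 0 \<or> f (snd p) < g (snd p) * Suc (fst p))"
      by (intro computable_intros assms[THEN computable_on_Times_snd])
    show "\<exists>q. g x = 0 \<or> f x < g x * Suc q" for x using less_mult_Suc_div by blast
  qed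
qed

lemma computable_on_even [computable_intros]:
  fixes f :: "'a::encodable \<Rightarrow> nat"
  assumes "computable_on D f"
  shows "computable_on D (\<lambda>x. even (f x))"
proof -
  have "computable_on D (\<lambda>x. f x = f x div 2 * 2)" by (intro computable_intros assms)
  moreover have "n = n div 2 * 2 \<longleftrightarrow> even n" for n :: nat
    by (metis dvd_div_mult_self dvd_triv_right)
  ultimately show ?thesis by (simp only:)
qed


subsection \<open>Canonical indices of finite sets\<close>

lemma computable_on_mem_set_decode [computable_intros]:
  assumes "computable_on D f" "computable_on D g"
  shows "computable_on D (\<lambda>x. f x \<in> set_decode (g x))"
  unfolding set_decode_def mem_Collect_eq by (intro computable_intros assms)

lemma set_decode_power_2: "set_decode (2 ^ n) = {n}"
  using set_encode_inverse[of "{n}"] by simp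

lemma mem_set_decode_imp_less: "i < n" if "i \<in> set_decode n"
proof -
  have "2 ^ i \<le> n"
    using that by (intro subset_decode_imp_le) (simp add: set_decode_power_2)
  then show ?thesis using less_exp[of i] by (rule order.strict_trans2[rotated])
qed

lemma computable_on_subset_set_decode [computable_intros]:
  assumes "computable_on D f" "computable_on D g"
  shows "computable_on D (\<lambda>x. set_decode (f x) \<subseteq> set_decode (g x))"
proof -
  have "computable_on D (\<lambda>x. \<forall>i<f x. i \<in> set_decode (f x) \<longrightarrow> i \<in> set_decode (g x))"
    by (intro computable_on_all_less computable_intros assms assms[THEN computable_on_Times_snd])
  moreover have "(\<forall>i<m. i \<in> set_decode m \<longrightarrow> i \<in> set_decode n) \<longleftrightarrow> set_decode m \<subseteq> set_decode n"
    for m n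
    using mem_set_decode_imp_less by blast
  ultimately show ?thesis by (simp only:)
qed

lemma set_encode_insert_if:
  "finite A \<Longrightarrow> set_encode (insert n A) =
    (if n \<in> set_decode (set_encode A) then set_encode A else 2 ^ n + set_encode A)"
  by (simp add: insert_absorb)


section \<open>Semidecidable predicates\<close>

definition semidecidable_on :: "'a::encodable set \<Rightarrow> ('a \<Rightarrow> bool) \<Rightarrow> bool" where
  "semidecidable_on D P \<longleftrightarrow>
    (\<exists>R :: nat \<times> 'a \<Rightarrow> bool. computable_on (UNIV \<times> D) R \<and> (\<forall>x\<in>D. P x \<longleftrightarrow> (\<exists>n. R (n, x))))"

lemma semidecidable_on_cong:
  "(\<And>x. x \<in> D \<Longrightarrow> P x \<longleftrightarrow> Q x) \<Longrightarrow> semidecidable_on D P \<longleftrightarrow> semidecidable_on D Q"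
  by (simp add: semidecidable_on_def)

lemma semidecidable_on_compose:
  fixes f :: "'b::encodable \<Rightarrow> 'a::encodable"
  assumes "semidecidable_on E P" "computable_on D f" "f ` D \<subseteq> E"
  shows "semidecidable_on D (\<lambda>x. P (f x))"
proof -
  obtain R where R: "computable_on (UNIV \<times> E) R" "\<forall>x\<in>E. P x \<longleftrightarrow> (\<exists>n :: nat. R (n, x))"
    using assms(1) unfolding semidecidable_on_def by blast
  have "computable_on (UNIV \<times> D) (\<lambda>p :: nat \<times> 'b. R (fst p, f (snd p)))"
    using assms(3)
    by (intro computable_on_compose[OF R(1)] computable_intros
        computable_on_Times_snd[OF assms(2)]) auto
  moreover have "P (f x) \<longleftrightarrow> (\<exists>n. R (fst (n, x), f (snd (n, x))))" if "x \<in> D" for x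
    using that R(2) assms(3) by auto
  ultimately show ?thesis unfolding semidecidable_on_def by blast
qed

lemmas semidecidable_on_unary = semidecidable_on_compose[where E = UNIV, simplified]

lemma Post_computable_on:
  assumes "semidecidable_on D P" "semidecidable_on D (\<lambda>x. \<not> P x)"
  shows "computable_on D P"
proof -
  obtain R where R: "computable_on (UNIV \<times> D) R" "\<And>x. x \<in> D \<Longrightarrow> P x \<longleftrightarrow> (\<exists>n :: nat. R (n, x))"
    using assms(1) unfolding semidecidable_on_def by blast
  obtain Q where Q: "computable_on (UNIV \<times> D) Q" "\<And>x. x \<in> D \<Longrightarrow> \<not> P x \<longleftrightarrow> (\<exists>n :: nat. Q (n, x))"
    using assms(2) unfolding semidecidable_on_def by blast
  define halt where "halt x = (LEAST n. R (n, x) \<or> Q (n, x))" for x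
  have found: "\<exists>n. R (n, x) \<or> Q (n, x)" if "x \<in> D" for x
    using R(2)[OF that] Q(2)[OF that] by blast
  have "computable_on D halt"
    unfolding halt_def using found
    by (intro computable_on_Least computable_on_disj) (simp_all add: R(1) Q(1))
  then have "computable_on D (\<lambda>x. R (halt x, x))"
    by (intro computable_on_compose[OF R(1)] computable_intros) auto
  moreover have "R (halt x, x) \<longleftrightarrow> P x" if "x \<in> D" for x
    using LeastI_ex[OF found[OF that]] R(2)[OF that] Q(2)[OF that] unfolding halt_def by blast
  ultimately show ?thesis by (simp cong: computable_on_encode_cong add: computable_on_def)
qed


section \<open>Enumerable types\<close>

class enumerable = encodable +
  assumes ex_enumeration_program: "\<exists>d e. surj d \<and> (\<forall>n. eval e [n] (encode (d n)))"

lemma ex_enumeration: "\<exists>d :: nat \<Rightarrow> 'a::enumerable. surj d \<and> computable d"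
  using ex_enumeration_program by (auto simp: computable_on_def)

lemma enumerable_classI:
  assumes "\<exists>d :: nat \<Rightarrow> 'a::encodable. surj d \<and> computable d"
  shows "OFCLASS('a, enumerable_class)"
  by standard (use assms in \<open>auto simp: computable_on_def\<close>)

lemma ex_recurrent_enumeration:
  "\<exists>d :: nat \<Rightarrow> 'a::enumerable. computable d \<and> (\<forall>x n. \<exists>m\<ge>n. d m = x)"
proof -
  obtain d :: "nat \<Rightarrow> 'a" where d: "surj d" "computable d"
    using ex_enumeration by blast
  have "\<exists>m\<ge>n. d (snd (prod_decode m)) = x" for x n
  proof -
    obtain k where "x = d k" using d(1) by (rule surjE)
    then show ?thesis
      using le_prod_encode_1[of n k] by (intro exI[of _ "prod_encode (n, k)"]) simp
  qed
  moreover have "computable (\<lambda>m. d (snd (prod_decode m)))"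
    by (intro computable_on_unary[OF d(2)] computable_intros)
  ultimately show ?thesis by blast
qed

lemma enumerable_classI_semidecidable_range:
  assumes "semidecidable_on UNIV (\<lambda>n. n \<in> range (encode :: 'a::encodable \<Rightarrow> nat))"
  shows "OFCLASS('a, enumerable_class)"
proof (rule enumerable_classI)
  obtain R :: "nat \<times> nat \<Rightarrow> bool" where R: "computable R"
    and range: "\<And>n. n \<in> range (encode :: 'a \<Rightarrow> nat) \<longleftrightarrow> (\<exists>s. R (s, n))"
    using assms unfolding semidecidable_on_def UNIV_Times_UNIV by blast
  define code where
    "code k = (if R (prod_decode k) then snd (prod_decode k) else encode (undefined :: 'a))" for k
  define d :: "nat \<Rightarrow> 'a" where "d k = inv encode (code k)" for k
  have "code k \<in> range (encode :: 'a \<Rightarrow> nat)" for k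
    using range[of "snd (prod_decode k)"] unfolding code_def by (metis prod.collapse rangeI)
  then have encode_d: "encode (d k) = code k" for k
    unfolding d_def by (rule f_inv_into_f)
  have "computable code"
    unfolding code_def by (intro computable_intros computable_on_unary[OF R])
  then have "computable d" by (simp add: computable_on_def encode_d)
  moreover have "\<exists>k. x = d k" for x
  proof -
    obtain s where "R (s, encode x)" using range[of "encode x"] by blast
    then have "encode x = encode (d (prod_encode (s, encode x)))" by (simp add: encode_d code_def)
    then show ?thesis unfolding encode_eq_iff by blast
  qed
  then have "surj d" by (simp add: surj_def)
  ultimately show "\<exists>d :: nat \<Rightarrow> 'a. surj d \<and> computable d" by blast
qed

instance nat :: enumerable
  by (intro enumerable_classI exI[of _ "\<lambda>n. n"] conjI surjI computable_on_ident) (rule refl)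

instance prod :: (enumerable, enumerable) enumerable
proof (rule enumerable_classI)
  obtain d :: "nat \<Rightarrow> 'a" where d: "surj d" "computable d" using ex_enumeration by blast
  obtain d' :: "nat \<Rightarrow> 'b" where d': "surj d'" "computable d'" using ex_enumeration by blast
  let ?d = "\<lambda>n. (d (fst (prod_decode n)), d' (snd (prod_decode n)))"
  have "\<exists>n. p = ?d n" for p
  proof -
    obtain m where "fst p = d m" using d(1) by (rule surjE)
    moreover obtain k where "snd p = d' k" using d'(1) by (rule surjE)
    ultimately show ?thesis by (intro exI[of _ "prod_encode (m, k)"]) (simp add: prod_eq_iff)
  qed
  then have "surj ?d" by (simp add: surj_def)
  moreover have "computable ?d"
    by (intro computable_intros computable_on_unary[OF d(2)] computable_on_unary[OF d'(2)])
  ultimately show "\<exists>d :: nat \<Rightarrow> 'a \<times> 'b. surj d \<and> computable d" by blast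
qed


section \<open>Inductive predicates are semidecidable\<close>

text \<open>Each rule of an inductive definition has finitely many premises, so the operator \<open>\<Phi>\<close> that it
  defines depends on finite parts of \<open>S\<close> only.  Such a part is given by the canonical index \<open>a\<close> of
  its set of codes.\<close>

definition enumerates ::
  "('b::encodable \<times> nat \<times> 'w::encodable \<Rightarrow> bool) \<Rightarrow>
    (('a::encodable \<Rightarrow> bool) \<Rightarrow> 'b \<Rightarrow> bool) \<Rightarrow> bool" where
  "enumerates R \<Phi> \<longleftrightarrow>
    (\<forall>S x. \<Phi> S x \<longleftrightarrow> (\<exists>a w. set_decode a \<subseteq> encode ` Collect S \<and> R (x, a, w)))"

definition enumeration_operator ::
  "(('a::encodable \<Rightarrow> bool) \<Rightarrow> 'b::encodable \<Rightarrow> bool) \<Rightarrow> bool" where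
  "enumeration_operator \<Phi> \<longleftrightarrow>
    (\<exists>R :: 'b \<times> nat \<times> nat \<Rightarrow> bool. computable R \<and> enumerates R \<Phi>)"

lemma enumeratesI:
  assumes "\<And>S x a w. set_decode a \<subseteq> encode ` Collect S \<Longrightarrow> R (x, a, w) \<Longrightarrow> \<Phi> S x"
    and "\<And>S x. \<Phi> S x \<Longrightarrow> \<exists>a w. set_decode a \<subseteq> encode ` Collect S \<and> R (x, a, w)"
  shows "enumerates R \<Phi>"
  unfolding enumerates_def using assms by blast

lemma enumerates_imp:
  "enumerates R \<Phi> \<Longrightarrow> set_decode a \<subseteq> encode ` Collect S \<Longrightarrow> R (x, a, w) \<Longrightarrow> \<Phi> S x"
  unfolding enumerates_def by blast

lemma enumeratesE:
  assumes "enumerates R \<Phi>" "\<Phi> S x"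
  obtains a w where "set_decode a \<subseteq> encode ` Collect S" "R (x, a, w)"
  using assms unfolding enumerates_def by blast

lemma enumerates_mono:
  assumes "enumerates R \<Phi>"
  shows "mono \<Phi>"
proof (intro monoI le_funI le_boolI)
  fix S T x
  assume "S \<le> T" "\<Phi> S x"
  moreover from this(2) obtain a w where "set_decode a \<subseteq> encode ` Collect S" "R (x, a, w)"
    by (rule enumeratesE[OF assms])
  ultimately show "\<Phi> T x"
    by (intro enumerates_imp[OF assms, of a _ x w]) (auto simp: le_fun_def)
qed

lemma enumeration_operatorI:
  fixes R :: "'b::encodable \<times> nat \<times> 'w::enumerable \<Rightarrow> bool"
  assumes "computable R" "enumerates R \<Phi>"
  shows "enumeration_operator \<Phi>"
proof -
  obtain d :: "nat \<Rightarrow> 'w" where d: "surj d" "computable d"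
    using ex_enumeration by blast
  have "computable (\<lambda>p. R (fst p, fst (snd p), d (snd (snd p))))"
    by (intro computable_on_unary[OF assms(1)] computable_on_unary[OF d(2)] computable_intros)
  moreover have witness_iff: "(\<exists>w. R (x, a, w)) \<longleftrightarrow> (\<exists>n. R (x, a, d n))" for x a
    using d(1) by (metis surjE)
  have "enumerates (\<lambda>p. R (fst p, fst (snd p), d (snd (snd p)))) \<Phi>"
    using assms(2) by (simp add: enumerates_def witness_iff)
  ultimately show ?thesis unfolding enumeration_operator_def by blast
qed

named_theorems enumeration_intros

lemma enumeration_operator_computable:
  fixes P :: "'b::encodable \<Rightarrow> bool"
  assumes "computable P"
  shows "enumeration_operator (\<lambda>(S :: 'a::encodable \<Rightarrow> bool) x. P x)"
proof (rule enumeration_operatorI)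
  show "computable (\<lambda>p :: 'b \<times> nat \<times> nat. P (fst p))"
    by (intro computable_on_unary[OF assms] computable_intros)
  show "enumerates (\<lambda>p :: 'b \<times> nat \<times> nat. P (fst p)) (\<lambda>(S :: 'a \<Rightarrow> bool) x. P x)"
    by (rule enumeratesI) (auto intro: exI[of _ 0])
qed

lemma enumeration_operator_const [enumeration_intros]: "enumeration_operator (\<lambda>S x. b)"
  by (intro enumeration_operator_computable computable_intros)

lemma enumeration_operator_eq [enumeration_intros]:
  "computable f \<Longrightarrow> computable g \<Longrightarrow> enumeration_operator (\<lambda>S x. f x = g x)"
  by (intro enumeration_operator_computable computable_intros)

lemma enumeration_operator_neq [enumeration_intros]:
  "computable f \<Longrightarrow> computable g \<Longrightarrow> enumeration_operator (\<lambda>S x. f x \<noteq> g x)"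
  by (intro enumeration_operator_computable computable_intros)

lemma enumeration_operator_atom [enumeration_intros]:
  fixes f :: "'b::encodable \<Rightarrow> 'a::encodable"
  assumes "computable f"
  shows "enumeration_operator (\<lambda>S x. S (f x))"
proof (rule enumeration_operatorI)
  let ?R = "\<lambda>p :: 'b \<times> nat \<times> nat. encode (f (fst p)) \<in> set_decode (fst (snd p))"
  show "computable ?R" by (intro computable_intros computable_on_unary[OF assms])
  show "enumerates ?R (\<lambda>S x. S (f x))"
    by (rule enumeratesI) (auto intro!: exI[of _ "2 ^ encode (f _)"] simp: set_decode_power_2)
qed

lemma enumeration_operator_conj [enumeration_intros]:
  fixes \<Phi> \<Psi> :: "('a::encodable \<Rightarrow> bool) \<Rightarrow> 'b::encodable \<Rightarrow> bool"
  assumes "enumeration_operator \<Phi>" "enumeration_operator \<Psi>"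
  shows "enumeration_operator (\<lambda>S x. \<Phi> S x \<and> \<Psi> S x)"
proof -
  obtain R :: "'b \<times> nat \<times> nat \<Rightarrow> bool" where R: "computable R" "enumerates R \<Phi>"
    using assms(1) unfolding enumeration_operator_def by blast
  obtain Q :: "'b \<times> nat \<times> nat \<Rightarrow> bool" where Q: "computable Q" "enumerates Q \<Psi>"
    using assms(2) unfolding enumeration_operator_def by blast
  let ?T = "\<lambda>(x, c, (a, u), b, v). set_decode a \<subseteq> set_decode c \<and> R (x, a, u) \<and>
    set_decode b \<subseteq> set_decode c \<and> Q (x, b, v)"
  have "computable ?T"
    unfolding case_prod_beta
    by (intro computable_intros computable_on_unary[OF R(1)] computable_on_unary[OF Q(1)])
  moreover have "enumerates ?T (\<lambda>S x. \<Phi> S x \<and> \<Psi> S x)"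
  proof (rule enumeratesI)
    show "\<Phi> S x \<and> \<Psi> S x"
      if c: "set_decode c \<subseteq> encode ` Collect S" and T: "?T (x, c, w)" for S x c w
    proof -
      obtain a u b v where w: "w = ((a, u), b, v)" by (metis prod.exhaust)
      have "R (x, a, u)" "set_decode a \<subseteq> encode ` Collect S"
        "Q (x, b, v)" "set_decode b \<subseteq> encode ` Collect S"
        using T subset_trans[OF _ c] by (simp_all add: w)
      then show ?thesis by (intro conjI enumerates_imp[OF R(2)] enumerates_imp[OF Q(2)])
    qed
    show "\<exists>c w. set_decode c \<subseteq> encode ` Collect S \<and> ?T (x, c, w)"
      if both: "\<Phi> S x \<and> \<Psi> S x" for S x
    proof -
      obtain a u where "set_decode a \<subseteq> encode ` Collect S" "R (x, a, u)"
        using conjunct1[OF both] by (rule enumeratesE[OF R(2)])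
      moreover obtain b v where "set_decode b \<subseteq> encode ` Collect S" "Q (x, b, v)"
        using conjunct2[OF both] by (rule enumeratesE[OF Q(2)])
      ultimately show ?thesis
        by (intro exI[of _ "set_encode (set_decode a \<union> set_decode b)"] exI[of _ "((a, u), b, v)"])
          simp
    qed
  qed
  ultimately show ?thesis by (rule enumeration_operatorI)
qed

lemma enumeration_operator_disj [enumeration_intros]:
  fixes \<Phi> \<Psi> :: "('a::encodable \<Rightarrow> bool) \<Rightarrow> 'b::encodable \<Rightarrow> bool"
  assumes "enumeration_operator \<Phi>" "enumeration_operator \<Psi>"
  shows "enumeration_operator (\<lambda>S x. \<Phi> S x \<or> \<Psi> S x)"
proof -
  obtain R :: "'b \<times> nat \<times> nat \<Rightarrow> bool" where R: "computable R" "enumerates R \<Phi>"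
    using assms(1) unfolding enumeration_operator_def by blast
  obtain Q :: "'b \<times> nat \<times> nat \<Rightarrow> bool" where Q: "computable Q" "enumerates Q \<Psi>"
    using assms(2) unfolding enumeration_operator_def by blast
  have "computable (\<lambda>p. R p \<or> Q p)" by (intro computable_on_disj R(1) Q(1))
  moreover have "enumerates (\<lambda>p. R p \<or> Q p) (\<lambda>S x. \<Phi> S x \<or> \<Psi> S x)"
    using R(2) Q(2) unfolding enumerates_def by blast
  ultimately show ?thesis by (rule enumeration_operatorI)
qed

lemma enumeration_operator_ex [enumeration_intros]:
  fixes \<Phi> :: "('a::encodable \<Rightarrow> bool) \<Rightarrow> 'b::encodable \<Rightarrow> 'c::enumerable \<Rightarrow> bool"
  assumes "enumeration_operator (\<lambda>S p. \<Phi> S (snd p) (fst p))"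
  shows "enumeration_operator (\<lambda>S x. \<exists>y. \<Phi> S x y)"
proof -
  obtain R :: "('c \<times> 'b) \<times> nat \<times> nat \<Rightarrow> bool"
    where R: "computable R" "enumerates R (\<lambda>S p. \<Phi> S (snd p) (fst p))"
    using assms unfolding enumeration_operator_def by blast
  have "computable (\<lambda>(x, a, y, w). R ((y, x), a, w))"
    unfolding case_prod_beta by (intro computable_on_unary[OF R(1)] computable_intros)
  moreover have witness_iff:
    "\<Phi> S x y \<longleftrightarrow> (\<exists>a w. set_decode a \<subseteq> encode ` Collect S \<and> R ((y, x), a, w))" for S x y
    using R(2)[unfolded enumerates_def, rule_format, of S "(y, x)"] by simp
  have "enumerates (\<lambda>(x, a, y, w). R ((y, x), a, w)) (\<lambda>S x. \<exists>y. \<Phi> S x y)"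
    by (simp add: enumerates_def witness_iff) blast
  ultimately show ?thesis by (rule enumeration_operatorI)
qed


subsection \<open>Least fixed points\<close>

primrec stage ::
  "('a::encodable \<times> nat \<times> nat \<Rightarrow> bool) \<Rightarrow> (nat \<Rightarrow> 'a \<times> nat \<times> nat) \<Rightarrow> nat \<Rightarrow> 'a set" where
  "stage R d 0 = {}"
| "stage R d (Suc n) = (if R (d n) \<and> set_decode (fst (snd (d n))) \<subseteq> encode ` stage R d n
    then insert (fst (d n)) (stage R d n) else stage R d n)"

lemma finite_stage [simp]: "finite (stage R d n)"
  by (induction n) auto

lemma mono_stage: "mono (stage R d)"
  by (auto simp: mono_iff_le_Suc)

lemma computable_encode_stage:
  assumes "computable R" "computable d"
  shows "computable (\<lambda>n. set_encode (encode ` stage R d n))"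
proof -
  define step where "step n a = (if R (d n) \<and> set_decode (fst (snd (d n))) \<subseteq> set_decode a
    then if encode (fst (d n)) \<in> set_decode a then a else 2 ^ encode (fst (d n)) + a else a)"
    for n a
  have "set_encode (encode ` stage R d (Suc n)) = step n (set_encode (encode ` stage R d n))" for n
    by (simp add: step_def set_encode_insert_if)
  then have "set_encode (encode ` stage R d n) = rec_nat 0 step n" for n
    by (induction n) (simp_all del: stage.simps(2))
  moreover have "computable (\<lambda>n. rec_nat 0 (\<lambda>i a. step i a) n)"
    unfolding step_def
    by (rule computable_on_rec_nat; intro computable_intros computable_on_unary[OF assms(1)]
        computable_on_unary[OF assms(2)])
  ultimately show ?thesis by simp
qed

lemma stage_subset_lfp:
  assumes "enumerates R \<Phi>"
  shows "stage R d n \<subseteq> Collect (lfp \<Phi>)"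
proof (induction n)
  case (Suc n)
  have "lfp \<Phi> (fst (d n))" if "R (d n)" "set_decode (fst (snd (d n))) \<subseteq> encode ` stage R d n"
  proof (subst lfp_unfold[OF enumerates_mono[OF assms]], rule enumerates_imp[OF assms])
    show "set_decode (fst (snd (d n))) \<subseteq> encode ` Collect (lfp \<Phi>)" using that(2) Suc by blast
    show "R (fst (d n), fst (snd (d n)), snd (snd (d n)))" using that(1) by simp
  qed
  then show ?case using Suc by auto
qed simp

lemma finite_subset_UN_mono:
  fixes A :: "'i::linorder \<Rightarrow> 'a set"
  assumes "mono A" "finite F" "F \<subseteq> (\<Union>i. A i)"
  shows "\<exists>i. F \<subseteq> A i"
  using assms(2,3)
proof (induction F)
  case (insert x F)
  then obtain i j where "F \<subseteq> A i" "x \<in> A j" by auto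
  then have "insert x F \<subseteq> A (max i j)"
    using monoD[OF assms(1), of i "max i j"] monoD[OF assms(1), of j "max i j"] by auto
  then show ?case by blast
qed simp

lemma lfp_subset_UN_stage:
  assumes recurrent: "\<And>p n. \<exists>m\<ge>n. d m = p" and "enumerates R \<Phi>"
  shows "Collect (lfp \<Phi>) \<subseteq> (\<Union>n. stage R d n)"
proof -
  let ?U = "\<lambda>x. x \<in> (\<Union>n. stage R d n)"
  have "?U x" if closed: "\<Phi> ?U x" for x
  proof -
    obtain a w where "set_decode a \<subseteq> encode ` Collect ?U" and R: "R (x, a, w)"
      using closed by (rule enumeratesE[OF assms(2)])
    then have "set_decode a \<subseteq> (\<Union>n. encode ` stage R d n)"
      by (simp only: Collect_mem_eq image_UN)
    moreover have "mono (\<lambda>n. encode ` stage R d n)"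
      using mono_stage[of R d] by (simp add: mono_def image_mono)
    ultimately obtain n where n: "set_decode a \<subseteq> encode ` stage R d n"
      using finite_subset_UN_mono[OF _ finite_set_decode] by blast
    \<comment> \<open>The premises of \<open>x\<close> may appear after \<open>(x, a, w)\<close> was first tried.\<close>
    obtain m where "n \<le> m" and m: "d m = (x, a, w)" using recurrent by blast
    then have "set_decode a \<subseteq> encode ` stage R d m"
      using n monoD[OF mono_stage[of R d]] by blast
    then have "x \<in> stage R d (Suc m)" by (simp add: m R)
    then show "?U x" by blast
  qed
  then have "lfp \<Phi> \<le> ?U" by (intro lfp_lowerbound le_funI le_boolI)
  then show ?thesis by (auto simp: le_fun_def)
qed

lemma semidecidable_lfp:
  fixes \<Phi> :: "('a::enumerable \<Rightarrow> bool) \<Rightarrow> 'a \<Rightarrow> bool"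
  assumes "enumeration_operator \<Phi>"
  shows "semidecidable_on UNIV (lfp \<Phi>)"
proof -
  obtain R :: "'a \<times> nat \<times> nat \<Rightarrow> bool" where R: "computable R" "enumerates R \<Phi>"
    using assms unfolding enumeration_operator_def by blast
  obtain d :: "nat \<Rightarrow> 'a \<times> nat \<times> nat" where d: "computable d" "\<And>p n. \<exists>m\<ge>n. d m = p"
    using ex_recurrent_enumeration by blast
  have "Collect (lfp \<Phi>) = (\<Union>n. stage R d n)"
    using stage_subset_lfp[OF R(2), of d] lfp_subset_UN_stage[OF d(2) R(2)] by blast
  then have "lfp \<Phi> x \<longleftrightarrow> (\<exists>n. x \<in> stage R d n)" for x
    by blast
  moreover have "computable (\<lambda>p :: nat \<times> 'a. snd p \<in> stage R d (fst p))"
  proof -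
    have "x \<in> stage R d n \<longleftrightarrow> encode x \<in> set_decode (set_encode (encode ` stage R d n))" for x n
      by (simp add: inj_image_mem_iff[OF inj_encode])
    then show ?thesis
      by (simp only:) (intro computable_intros
          computable_on_unary[OF computable_encode_stage[OF R(1) d(1)]])
  qed
  ultimately show ?thesis
    unfolding semidecidable_on_def UNIV_Times_UNIV
    by (intro exI[of _ "\<lambda>p. snd p \<in> stage R d (fst p)"]) simp
qed

lemma semidecidable_if_enumeration_operator:
  fixes P :: "'a::enumerable \<Rightarrow> bool"
  assumes "enumeration_operator (\<lambda>(S :: 'a \<Rightarrow> bool) x. P x)"
  shows "semidecidable_on UNIV P"
  using semidecidable_lfp[OF assms] by (simp add: lfp_const)


section \<open>Syntax is enumerable\<close>

instantiation tm :: encodable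
begin

definition "encode = tm_code"

instance by standard (simp add: encode_tm_def inj_tm_code)

end

instantiation fm :: encodable
begin

definition "encode = fm_code"

instance by standard (simp add: encode_fm_def inj_fm_code)

end

lemma encode_tm:
  "encode (Var x) = encode (0 :: nat, x)"
  "encode (Fn f ts) = encode (1 :: nat, f, ts)"
  by (simp_all add: encode_tm_def encode_list_def)

lemma encode_fm:
  "encode Bot = encode (0 :: nat, 0 :: nat)"
  "encode (Pre p ts) = encode (1 :: nat, p, ts)"
  "encode (Eql s t) = encode (2 :: nat, s, t)"
  "encode (Imp \<phi> \<psi>) = encode (3 :: nat, \<phi>, \<psi>)"
  "encode (Forall x \<phi>) = encode (4 :: nat, x, \<phi>)"
  by (simp_all add: encode_tm_def encode_fm_def encode_list_def)

lemma computable_on_syntax [computable_intros]: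
  "computable_on D x \<Longrightarrow> computable_on D (\<lambda>a. Var (x a))"
  "computable_on D f \<Longrightarrow> computable_on D ts \<Longrightarrow> computable_on D (\<lambda>a. Fn (f a) (ts a))"
  "computable_on D f \<Longrightarrow> computable_on D ts \<Longrightarrow> computable_on D (\<lambda>a. Pre (f a) (ts a))"
  "computable_on D s \<Longrightarrow> computable_on D t \<Longrightarrow> computable_on D (\<lambda>a. Eql (s a) (t a))"
  "computable_on D \<phi> \<Longrightarrow> computable_on D \<psi> \<Longrightarrow> computable_on D (\<lambda>a. Imp (\<phi> a) (\<psi> a))"
  "computable_on D x \<Longrightarrow> computable_on D \<phi> \<Longrightarrow> computable_on D (\<lambda>a. Forall (x a) (\<phi> a))"
  by (rule computable_on_if_encode, unfold encode_tm encode_fm,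
      intro computable_intros; assumption)+

text \<open>Terms and lists of terms are defined by mutual recursion; as a term is given by its singleton
  list, one predicate on codes of lists suffices.\<close>

context notes [[inductive_internals]]
begin

inductive forest_code :: "nat \<Rightarrow> bool" where
  forest_code_Nil: "forest_code 0"
| forest_code_Var: "forest_code l \<Longrightarrow>
    forest_code (Suc (prod_encode (encode (0 :: nat, x :: nat), l)))"
| forest_code_Fn: "forest_code k \<Longrightarrow> forest_code l \<Longrightarrow>
    forest_code (Suc (prod_encode (encode (1 :: nat, f :: nat, k), l)))"

inductive list_code :: "('a \<Rightarrow> nat) \<Rightarrow> nat \<Rightarrow> bool" for code where
  list_code_Nil: "list_code code 0"
| list_code_Cons: "list_code code l \<Longrightarrow> list_code code (Suc (prod_encode (code x, l)))"

inductive formula_code :: "nat \<Rightarrow> bool" where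
  formula_code_Bot: "formula_code (encode Bot)"
| formula_code_Pre: "formula_code (encode (Pre p ts))"
| formula_code_Eql: "formula_code (encode (Eql s t))"
| formula_code_Imp: "formula_code a \<Longrightarrow> formula_code b \<Longrightarrow> formula_code (encode (3 :: nat, a, b))"
| formula_code_Forall: "formula_code a \<Longrightarrow> formula_code (encode (4 :: nat, x :: nat, a))"

end

lemma forest_code_Cons: "forest_code l \<Longrightarrow> forest_code (Suc (prod_encode (encode (t :: tm), l)))"
proof (induction t arbitrary: l)
  case (Var x)
  then show ?case unfolding encode_tm by (rule forest_code_Var)
next
  case (Fn f ts)
  from Fn.IH have "forest_code (encode ts)"
    by (induction ts) (simp_all add: forest_code_Nil)
  from forest_code_Fn[OF this Fn.prems] show ?case by (simp add: encode_tm)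
qed

lemma forest_codeD: "forest_code l \<Longrightarrow> \<exists>ts :: tm list. l = encode ts"
proof (induction rule: forest_code.induct)
  case forest_code_Nil
  then show ?case by (intro exI[of _ "[]"]) simp
next
  case (forest_code_Var l x)
  then obtain ts :: "tm list" where "l = encode ts" by blast
  then show ?case by (intro exI[of _ "Var x # ts"]) (simp add: encode_tm)
next
  case (forest_code_Fn k l f)
  then obtain us ts :: "tm list" where "k = encode us" "l = encode ts" by blast
  then show ?case by (intro exI[of _ "Fn f us # ts"]) (simp add: encode_tm)
qed

instance tm :: enumerable
proof (rule enumerable_classI_semidecidable_range)
  have "n \<in> range (encode :: tm \<Rightarrow> nat) \<longleftrightarrow> forest_code (Suc (prod_encode (n, 0)))" for n
  proof
    assume "n \<in> range (encode :: tm \<Rightarrow> nat)"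
    then show "forest_code (Suc (prod_encode (n, 0)))"
      by (auto intro: forest_code_Cons forest_code_Nil)
  next
    assume "forest_code (Suc (prod_encode (n, 0)))"
    then obtain ts :: "tm list" where "Suc (prod_encode (n, 0)) = encode ts"
      using forest_codeD by blast
    then show "n \<in> range (encode :: tm \<Rightarrow> nat)" by (cases ts) auto
  qed
  moreover have "semidecidable_on UNIV forest_code"
    unfolding forest_code_def
    by (rule semidecidable_lfp) (intro enumeration_intros computable_intros)
  ultimately show "semidecidable_on UNIV (\<lambda>n. n \<in> range (encode :: tm \<Rightarrow> nat))"
    by (simp only:) (rule semidecidable_on_unary, assumption, intro computable_intros)
qed

lemma list_code_iff:
  "list_code (encode :: 'a::encodable \<Rightarrow> nat) n \<longleftrightarrow> n \<in> range (encode :: 'a list \<Rightarrow> nat)"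
  (is "?L \<longleftrightarrow> ?R")
proof
  show "?L \<Longrightarrow> ?R"
  proof (induction rule: list_code.induct)
    case list_code_Nil
    show ?case by (intro image_eqI[of _ _ "[]"]) simp_all
  next
    case (list_code_Cons l x)
    then obtain xs :: "'a list" where "l = encode xs" by blast
    then show ?case by (intro image_eqI[of _ _ "x # xs"]) simp_all
  qed
  have "list_code (encode :: 'a \<Rightarrow> nat) (encode xs)" for xs :: "'a list"
    by (induction xs) (auto intro: list_code_Nil list_code_Cons)
  then show "?R \<Longrightarrow> ?L" by blast
qed

instance list :: (enumerable) enumerable
proof (rule enumerable_classI_semidecidable_range)
  show "semidecidable_on UNIV (\<lambda>n. n \<in> range (encode :: 'a list \<Rightarrow> nat))"
    unfolding list_code_iff[symmetric] list_code_def
    by (rule semidecidable_lfp) (intro enumeration_intros computable_intros)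
qed

lemma formula_code_iff: "formula_code n \<longleftrightarrow> n \<in> range (encode :: fm \<Rightarrow> nat)" (is "?L \<longleftrightarrow> ?R")
proof
  show "?L \<Longrightarrow> ?R"
  proof (induction rule: formula_code.induct)
    case (formula_code_Imp a b)
    then obtain \<phi> \<psi> :: fm where "a = encode \<phi>" "b = encode \<psi>" by blast
    then show ?case by (intro image_eqI[of _ _ "Imp \<phi> \<psi>"]) (simp_all add: encode_fm)
  next
    case (formula_code_Forall a x)
    then obtain \<phi> :: fm where "a = encode \<phi>" by blast
    then show ?case by (intro image_eqI[of _ _ "Forall x \<phi>"]) (simp_all add: encode_fm)
  qed blast+
  have "formula_code (encode \<phi>)" for \<phi> :: fm
  proof (induction \<phi>)
    case (Imp \<phi> \<psi>)
    then show ?case using formula_code.formula_code_Imp by (simp add: encode_fm)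
  next
    case (Forall x \<phi>)
    then show ?case using formula_code.formula_code_Forall by (simp add: encode_fm)
  qed (rule formula_code_Bot formula_code_Pre formula_code_Eql)+
  then show "?R \<Longrightarrow> ?L" by blast
qed

instance fm :: enumerable
proof (rule enumerable_classI_semidecidable_range)
  show "semidecidable_on UNIV (\<lambda>n. n \<in> range (encode :: fm \<Rightarrow> nat))"
    unfolding formula_code_iff[symmetric] formula_code_def
    by (rule semidecidable_lfp) (intro enumeration_intros computable_intros)
qed


section \<open>Provability is semidecidable\<close>

fun function_symbols :: "language \<Rightarrow> (nat \<times> nat) set" where
  "function_symbols (Propositional A) = {}"
| "function_symbols (FirstOrder F P e) = F"

fun predicate_symbols :: "language \<Rightarrow> (nat \<times> nat) set" where
  "predicate_symbols (Propositional A) = A \<times> {0}"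
| "predicate_symbols (FirstOrder F P e) = P"

fun has_equality :: "language \<Rightarrow> bool" where
  "has_equality (Propositional A) = False"
| "has_equality (FirstOrder F P e) = e"

fun has_quantifiers :: "language \<Rightarrow> bool" where
  "has_quantifiers (Propositional A) = False"
| "has_quantifiers (FirstOrder F P e) = True"

lemma is_formula_symbols:
  "is_formula L (Pre p ts) \<longleftrightarrow>
    (p, length ts) \<in> predicate_symbols L \<and> (\<forall>t\<in>set ts. is_term (function_symbols L) t)"
  "is_formula L (Eql s t) \<longleftrightarrow>
    has_equality L \<and> is_term (function_symbols L) s \<and> is_term (function_symbols L) t"
  "is_formula L (Forall x \<phi>) \<longleftrightarrow> has_quantifiers L \<and> is_formula L \<phi>"
  by (cases L; auto)+

declare is_formula.simps(2,3,5) [simp del] is_formula_symbols [simp]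

lemma computable_symbols:
  assumes "effectively_presented L"
  shows "computable (\<lambda>s. s \<in> function_symbols L)" "computable (\<lambda>s. s \<in> predicate_symbols L)"
proof -
  have encode_nat_eq: "(encode :: nat \<Rightarrow> nat) = id" "(encode :: nat \<times> nat \<Rightarrow> nat) = prod_encode"
    by (simp_all add: fun_eq_iff)
  have "computable (\<lambda>s. s \<in> function_symbols L) \<and> computable (\<lambda>s. s \<in> predicate_symbols L)"
  proof (cases L)
    case (Propositional A)
    then have A: "computable (\<lambda>p. p \<in> A)"
      using assms by (simp flip: decidable_on_iff_computable_on add: encode_nat_eq)
    have "computable (\<lambda>s. fst s \<in> A \<and> snd s = (0 :: nat))"
      by (intro computable_intros computable_on_unary[OF A])
    then show ?thesis
      using Propositional by (simp add: computable_on_const mem_Times_iff)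
  next
    case (FirstOrder F P e)
    then show ?thesis
      using assms by (simp flip: decidable_on_iff_computable_on add: encode_nat_eq)
  qed
  then show "computable (\<lambda>s. s \<in> function_symbols L)" "computable (\<lambda>s. s \<in> predicate_symbols L)"
    by blast+
qed

datatype judgement =
    IsTerm tm
  | AreTerms nat "tm list"
  | IsFormula fm
  | NotInTerm nat tm
  | NotInTerms nat "tm list"
  | NotFree nat fm
  | SubstTerm nat tm tm tm
  | SubstTerms nat tm "tm list" "tm list"
  | SubstFormula nat tm fm fm
  | FreeFor tm nat fm
  | Theorem fm

fun valid :: "language \<Rightarrow> judgement \<Rightarrow> bool" where
  "valid L (IsTerm t) \<longleftrightarrow> is_term (function_symbols L) t"
| "valid L (AreTerms n ts) \<longleftrightarrow> n = length ts \<and> (\<forall>t\<in>set ts. is_term (function_symbols L) t)"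
| "valid L (IsFormula \<phi>) \<longleftrightarrow> is_formula L \<phi>"
| "valid L (NotInTerm x t) \<longleftrightarrow> x \<notin> fv_tm t"
| "valid L (NotInTerms x ts) \<longleftrightarrow> (\<forall>t\<in>set ts. x \<notin> fv_tm t)"
| "valid L (NotFree x \<phi>) \<longleftrightarrow> x \<notin> fv \<phi>"
| "valid L (SubstTerm x s t t') \<longleftrightarrow> t' = subst_tm x s t"
| "valid L (SubstTerms x s ts ts') \<longleftrightarrow> ts' = map (subst_tm x s) ts"
| "valid L (SubstFormula x s \<phi> \<phi>') \<longleftrightarrow> \<phi>' = subst x s \<phi>"
| "valid L (FreeFor s x \<phi>) \<longleftrightarrow> free_for s x \<phi>"
| "valid L (Theorem \<phi>) \<longleftrightarrow> derives L {} \<phi>"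

text \<open>Generating the syntactic side conditions of the Hilbert calculus together with its theorems
  avoids programming any recursion on codes.\<close>

context notes [[inductive_internals]]
begin

inductive holds :: "language \<Rightarrow> judgement \<Rightarrow> bool" for L where
  IsTerm_Var: "holds L (IsTerm (Var x))"
| IsTerm_Fn: "(f, n) \<in> function_symbols L \<Longrightarrow> holds L (AreTerms n ts) \<Longrightarrow> holds L (IsTerm (Fn f ts))"
| AreTerms_Nil: "holds L (AreTerms 0 [])"
| AreTerms_Cons: "holds L (IsTerm t) \<Longrightarrow> holds L (AreTerms n ts) \<Longrightarrow>
    holds L (AreTerms (Suc n) (t # ts))"
| IsFormula_Bot: "holds L (IsFormula Bot)"
| IsFormula_Pre: "(p, n) \<in> predicate_symbols L \<Longrightarrow> holds L (AreTerms n ts) \<Longrightarrow>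
    holds L (IsFormula (Pre p ts))"
| IsFormula_Eql: "has_equality L \<Longrightarrow> holds L (IsTerm s) \<Longrightarrow> holds L (IsTerm t) \<Longrightarrow>
    holds L (IsFormula (Eql s t))"
| IsFormula_Imp: "holds L (IsFormula \<phi>) \<Longrightarrow> holds L (IsFormula \<psi>) \<Longrightarrow> holds L (IsFormula (Imp \<phi> \<psi>))"
| IsFormula_Forall: "has_quantifiers L \<Longrightarrow> holds L (IsFormula \<phi>) \<Longrightarrow> holds L (IsFormula (Forall x \<phi>))"
| NotInTerm_Var: "x \<noteq> y \<Longrightarrow> holds L (NotInTerm x (Var y))"
| NotInTerm_Fn: "holds L (NotInTerms x ts) \<Longrightarrow> holds L (NotInTerm x (Fn f ts))"
| NotInTerms_Nil: "holds L (NotInTerms x [])"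
| NotInTerms_Cons: "holds L (NotInTerm x t) \<Longrightarrow> holds L (NotInTerms x ts) \<Longrightarrow>
    holds L (NotInTerms x (t # ts))"
| NotFree_Bot: "holds L (NotFree x Bot)"
| NotFree_Pre: "holds L (NotInTerms x ts) \<Longrightarrow> holds L (NotFree x (Pre p ts))"
| NotFree_Eql: "holds L (NotInTerm x s) \<Longrightarrow> holds L (NotInTerm x t) \<Longrightarrow> holds L (NotFree x (Eql s t))"
| NotFree_Imp: "holds L (NotFree x \<phi>) \<Longrightarrow> holds L (NotFree x \<psi>) \<Longrightarrow> holds L (NotFree x (Imp \<phi> \<psi>))"
| NotFree_Forall_same: "holds L (NotFree x (Forall x \<phi>))"
| NotFree_Forall: "holds L (NotFree x \<phi>) \<Longrightarrow> holds L (NotFree x (Forall y \<phi>))"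
| SubstTerm_Var_same: "holds L (SubstTerm x s (Var x) s)"
| SubstTerm_Var: "x \<noteq> y \<Longrightarrow> holds L (SubstTerm x s (Var y) (Var y))"
| SubstTerm_Fn: "holds L (SubstTerms x s ts ts') \<Longrightarrow> holds L (SubstTerm x s (Fn f ts) (Fn f ts'))"
| SubstTerms_Nil: "holds L (SubstTerms x s [] [])"
| SubstTerms_Cons: "holds L (SubstTerm x s t t') \<Longrightarrow> holds L (SubstTerms x s ts ts') \<Longrightarrow>
    holds L (SubstTerms x s (t # ts) (t' # ts'))"
| SubstFormula_Bot: "holds L (SubstFormula x s Bot Bot)"
| SubstFormula_Pre: "holds L (SubstTerms x s ts ts') \<Longrightarrow>
    holds L (SubstFormula x s (Pre p ts) (Pre p ts'))"
| SubstFormula_Eql: "holds L (SubstTerm x s t t') \<Longrightarrow> holds L (SubstTerm x s u u') \<Longrightarrow>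
    holds L (SubstFormula x s (Eql t u) (Eql t' u'))"
| SubstFormula_Imp: "holds L (SubstFormula x s \<phi> \<phi>') \<Longrightarrow> holds L (SubstFormula x s \<psi> \<psi>') \<Longrightarrow>
    holds L (SubstFormula x s (Imp \<phi> \<psi>) (Imp \<phi>' \<psi>'))"
| SubstFormula_Forall_same: "holds L (SubstFormula x s (Forall x \<phi>) (Forall x \<phi>))"
| SubstFormula_Forall: "x \<noteq> y \<Longrightarrow> holds L (SubstFormula x s \<phi> \<phi>') \<Longrightarrow>
    holds L (SubstFormula x s (Forall y \<phi>) (Forall y \<phi>'))"
| FreeFor_Bot: "holds L (FreeFor s x Bot)"
| FreeFor_Pre: "holds L (FreeFor s x (Pre p ts))"
| FreeFor_Eql: "holds L (FreeFor s x (Eql t u))"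
| FreeFor_Imp: "holds L (FreeFor s x \<phi>) \<Longrightarrow> holds L (FreeFor s x \<psi>) \<Longrightarrow> holds L (FreeFor s x (Imp \<phi> \<psi>))"
| FreeFor_Forall_not_free: "holds L (NotFree x (Forall y \<phi>)) \<Longrightarrow> holds L (FreeFor s x (Forall y \<phi>))"
| FreeFor_Forall: "holds L (NotInTerm y s) \<Longrightarrow> holds L (FreeFor s x \<phi>) \<Longrightarrow>
    holds L (FreeFor s x (Forall y \<phi>))"
| Theorem_K: "holds L (IsFormula \<phi>) \<Longrightarrow> holds L (IsFormula \<psi>) \<Longrightarrow> holds L (Theorem (Imp \<phi> (Imp \<psi> \<phi>)))"
| Theorem_S: "holds L (IsFormula \<phi>) \<Longrightarrow> holds L (IsFormula \<psi>) \<Longrightarrow> holds L (IsFormula \<chi>) \<Longrightarrow>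
    holds L (Theorem (Imp (Imp \<phi> (Imp \<psi> \<chi>)) (Imp (Imp \<phi> \<psi>) (Imp \<phi> \<chi>))))"
| Theorem_DN: "holds L (IsFormula \<phi>) \<Longrightarrow> holds L (Theorem (Imp (Neg (Neg \<phi>)) \<phi>))"
| Theorem_Inst: "holds L (IsFormula (Imp (Forall x \<phi>) \<psi>)) \<Longrightarrow> holds L (SubstFormula x t \<phi> \<psi>) \<Longrightarrow>
    holds L (FreeFor t x \<phi>) \<Longrightarrow> holds L (Theorem (Imp (Forall x \<phi>) \<psi>))"
| Theorem_Distr: "holds L (IsFormula (Forall x (Imp \<phi> \<psi>))) \<Longrightarrow> holds L (NotFree x \<phi>) \<Longrightarrow>
    holds L (Theorem (Imp (Forall x (Imp \<phi> \<psi>)) (Imp \<phi> (Forall x \<psi>))))"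
| Theorem_Refl: "holds L (IsFormula (Eql t t)) \<Longrightarrow> holds L (Theorem (Eql t t))"
| Theorem_Leibniz: "holds L (IsFormula (Eql s t)) \<Longrightarrow> holds L (IsFormula \<phi>) \<Longrightarrow>
    holds L (FreeFor s x \<phi>) \<Longrightarrow> holds L (FreeFor t x \<phi>) \<Longrightarrow>
    holds L (SubstFormula x s \<phi> \<psi>) \<Longrightarrow> holds L (SubstFormula x t \<phi> \<chi>) \<Longrightarrow>
    holds L (Theorem (Imp (Eql s t) (Imp \<psi> \<chi>)))"
| Theorem_MP: "holds L (Theorem (Imp \<phi> \<psi>)) \<Longrightarrow> holds L (Theorem \<phi>) \<Longrightarrow> holds L (Theorem \<psi>)"
| Theorem_Gen: "holds L (Theorem \<phi>) \<Longrightarrow> holds L (IsFormula (Forall x \<phi>)) \<Longrightarrow>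
    holds L (Theorem (Forall x \<phi>))"

end


subsection \<open>The judgements that hold are the valid ones\<close>

lemma valid_if_holds: "holds L j \<Longrightarrow> valid L j"
proof (induction rule: holds.induct)
  case (Theorem_MP \<phi> \<psi>)
  then show ?case by (auto intro: derives.MP)
next
  case (Theorem_Gen \<phi> x)
  then show ?case by (auto intro: derives.Gen)
qed (auto intro: derives.K derives.S derives.DN derives.Inst derives.Distr derives.Refl
    derives.Leibniz)

lemma holds_AreTerms:
  "(\<And>t. t \<in> set ts \<Longrightarrow> holds L (IsTerm t)) \<Longrightarrow> holds L (AreTerms (length ts) ts)"
  by (induction ts) (auto intro: AreTerms_Nil AreTerms_Cons)

lemma holds_IsTerm: "is_term (function_symbols L) t \<Longrightarrow> holds L (IsTerm t)"
  by (induction t) (auto intro: IsTerm_Var IsTerm_Fn holds_AreTerms)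

lemma holds_IsFormula: "is_formula L \<phi> \<Longrightarrow> holds L (IsFormula \<phi>)"
  by (induction \<phi>) (auto intro: holds.intros holds_IsTerm holds_AreTerms)

lemma holds_NotInTerms:
  "(\<And>t. t \<in> set ts \<Longrightarrow> holds L (NotInTerm x t)) \<Longrightarrow> holds L (NotInTerms x ts)"
  by (induction ts) (auto intro: NotInTerms_Nil NotInTerms_Cons)

lemma holds_NotInTerm: "x \<notin> fv_tm t \<Longrightarrow> holds L (NotInTerm x t)"
  by (induction t) (auto intro: NotInTerm_Var NotInTerm_Fn holds_NotInTerms)

lemma holds_NotFree: "x \<notin> fv \<phi> \<Longrightarrow> holds L (NotFree x \<phi>)"
  by (induction \<phi>) (auto intro: holds.intros holds_NotInTerm holds_NotInTerms)

lemma holds_SubstTerms: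
  "(\<And>t. t \<in> set ts \<Longrightarrow> holds L (SubstTerm x s t (subst_tm x s t))) \<Longrightarrow>
    holds L (SubstTerms x s ts (map (subst_tm x s) ts))"
  by (induction ts) (auto intro: SubstTerms_Nil SubstTerms_Cons)

lemma holds_SubstTerm: "holds L (SubstTerm x s t (subst_tm x s t))"
  by (induction t) (auto intro: SubstTerm_Var_same SubstTerm_Var SubstTerm_Fn holds_SubstTerms)

lemma holds_SubstFormula: "holds L (SubstFormula x s \<phi> (subst x s \<phi>))"
  by (induction \<phi>) (auto intro: holds.intros holds_SubstTerm holds_SubstTerms)

lemma holds_FreeFor: "free_for s x \<phi> \<Longrightarrow> holds L (FreeFor s x \<phi>)"
proof (induction \<phi>)
  case (Forall y \<phi>)
  then show ?case
    using FreeFor_Forall_not_free[OF holds_NotFree] FreeFor_Forall[OF holds_NotInTerm] by auto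
qed (auto intro: FreeFor_Bot FreeFor_Pre FreeFor_Eql FreeFor_Imp)

lemma holds_Theorem: "derives L {} \<phi> \<Longrightarrow> holds L (Theorem \<phi>)"
proof (induction rule: derives.induct)
  case (MP \<phi> \<psi>)
  from MP.IH show ?case by (rule Theorem_MP)
next
  case (Gen \<phi> x)
  from Gen.IH holds_IsFormula[OF Gen.hyps(2)] show ?case by (rule Theorem_Gen)
qed (blast intro: Theorem_K Theorem_S Theorem_DN Theorem_Inst Theorem_Distr Theorem_Refl
    Theorem_Leibniz holds_IsFormula holds_SubstFormula holds_FreeFor holds_NotFree)+

lemma holds_Theorem_iff: "holds L (Theorem \<phi>) \<longleftrightarrow> derives L {} \<phi>"
  using holds_Theorem valid_if_holds[of L "Theorem \<phi>"] by auto


subsection \<open>The inductive definition is computable\<close>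

fun judgement_code :: "judgement \<Rightarrow> nat" where
  "judgement_code (IsTerm t) = encode (0 :: nat, t)"
| "judgement_code (AreTerms n ts) = encode (1 :: nat, n, ts)"
| "judgement_code (IsFormula \<phi>) = encode (2 :: nat, \<phi>)"
| "judgement_code (NotInTerm x t) = encode (3 :: nat, x, t)"
| "judgement_code (NotInTerms x ts) = encode (4 :: nat, x, ts)"
| "judgement_code (NotFree x \<phi>) = encode (5 :: nat, x, \<phi>)"
| "judgement_code (SubstTerm x s t t') = encode (6 :: nat, x, s, t, t')"
| "judgement_code (SubstTerms x s ts ts') = encode (7 :: nat, x, s, ts, ts')"
| "judgement_code (SubstFormula x s \<phi> \<phi>') = encode (8 :: nat, x, s, \<phi>, \<phi>')"
| "judgement_code (FreeFor s x \<phi>) = encode (9 :: nat, s, x, \<phi>)"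
| "judgement_code (Theorem \<phi>) = encode (10 :: nat, \<phi>)"

instantiation judgement :: encodable
begin

definition "encode = judgement_code"

instance
proof
  have "j = k" if "judgement_code j = judgement_code k" for j k
    using that by (cases j; cases k) simp_all
  then show "inj (encode :: judgement \<Rightarrow> nat)"
    unfolding encode_judgement_def by (rule injI)
qed

end

lemma computable_on_judgement [computable_intros]:
  "computable_on D t \<Longrightarrow> computable_on D (\<lambda>a. IsTerm (t a))"
  "computable_on D n \<Longrightarrow> computable_on D ts \<Longrightarrow> computable_on D (\<lambda>a. AreTerms (n a) (ts a))"
  "computable_on D \<phi> \<Longrightarrow> computable_on D (\<lambda>a. IsFormula (\<phi> a))"
  "computable_on D x \<Longrightarrow> computable_on D t \<Longrightarrow> computable_on D (\<lambda>a. NotInTerm (x a) (t a))"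
  "computable_on D x \<Longrightarrow> computable_on D ts \<Longrightarrow> computable_on D (\<lambda>a. NotInTerms (x a) (ts a))"
  "computable_on D x \<Longrightarrow> computable_on D \<phi> \<Longrightarrow> computable_on D (\<lambda>a. NotFree (x a) (\<phi> a))"
  "computable_on D x \<Longrightarrow> computable_on D s \<Longrightarrow> computable_on D t \<Longrightarrow> computable_on D t' \<Longrightarrow>
    computable_on D (\<lambda>a. SubstTerm (x a) (s a) (t a) (t' a))"
  "computable_on D x \<Longrightarrow> computable_on D s \<Longrightarrow> computable_on D ts \<Longrightarrow> computable_on D ts' \<Longrightarrow>
    computable_on D (\<lambda>a. SubstTerms (x a) (s a) (ts a) (ts' a))"
  "computable_on D x \<Longrightarrow> computable_on D s \<Longrightarrow> computable_on D \<phi> \<Longrightarrow> computable_on D \<phi>' \<Longrightarrow>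
    computable_on D (\<lambda>a. SubstFormula (x a) (s a) (\<phi> a) (\<phi>' a))"
  "computable_on D s \<Longrightarrow> computable_on D x \<Longrightarrow> computable_on D \<phi> \<Longrightarrow>
    computable_on D (\<lambda>a. FreeFor (s a) (x a) (\<phi> a))"
  "computable_on D \<phi> \<Longrightarrow> computable_on D (\<lambda>a. Theorem (\<phi> a))"
  by (rule computable_on_if_encode, unfold encode_judgement_def judgement_code.simps,
      intro computable_intros; assumption)+

lemma ex_judgement_iff:
  "(\<exists>j. P j) \<longleftrightarrow> (\<exists>t. P (IsTerm t)) \<or> (\<exists>n ts. P (AreTerms n ts)) \<or> (\<exists>\<phi>. P (IsFormula \<phi>)) \<or>
    (\<exists>x t. P (NotInTerm x t)) \<or> (\<exists>x ts. P (NotInTerms x ts)) \<or> (\<exists>x \<phi>. P (NotFree x \<phi>)) \<or>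
    (\<exists>x s t t'. P (SubstTerm x s t t')) \<or> (\<exists>x s ts ts'. P (SubstTerms x s ts ts')) \<or>
    (\<exists>x s \<phi> \<phi>'. P (SubstFormula x s \<phi> \<phi>')) \<or> (\<exists>s x \<phi>. P (FreeFor s x \<phi>)) \<or> (\<exists>\<phi>. P (Theorem \<phi>))"
  (is "_ \<longleftrightarrow> ?R")
proof
  assume "\<exists>j. P j"
  then obtain j where "P j" ..
  then show ?R by (cases j) auto
next
  assume ?R
  then show "\<exists>j. P j" by auto
qed

instance judgement :: enumerable
proof (rule enumerable_classI_semidecidable_range)
  have "n \<in> range (encode :: judgement \<Rightarrow> nat) \<longleftrightarrow> (\<exists>j :: judgement. n = encode j)" for n
    by blast
  then show "semidecidable_on UNIV (\<lambda>n. n \<in> range (encode :: judgement \<Rightarrow> nat))"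
    unfolding ex_judgement_iff
    by (simp only:)
      (intro semidecidable_if_enumeration_operator enumeration_intros computable_intros)
qed

lemma semidecidable_holds:
  assumes "effectively_presented L"
  shows "semidecidable_on UNIV (holds L)"
  unfolding holds_def
  by (rule semidecidable_lfp)
    (intro enumeration_intros computable_intros
      enumeration_operator_computable[OF computable_on_unary[OF computable_symbols(1)[OF assms]]]
      enumeration_operator_computable[OF computable_on_unary[OF computable_symbols(2)[OF assms]]])

lemma semidecidable_derives:
  assumes "effectively_presented L"
  shows "semidecidable_on UNIV (derives L {})"
proof -
  have "semidecidable_on UNIV (\<lambda>\<phi>. holds L (Theorem \<phi>))"
    by (rule semidecidable_on_unary[OF semidecidable_holds[OF assms]]) (intro computable_intros)
  then show ?thesis by (simp only: holds_Theorem_iff)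
qed


section \<open>Computable real functions\<close>

subsection \<open>Integer arithmetic\<close>

lemma int_encode_if:
  "int_encode i = (if 0 \<le> i then 2 * nat i else Suc (2 * nat (- i - 1)))"
  by (simp add: int_encode_def sum_encode_def)

lemma computable_on_int_decode [computable_intros]:
  "computable_on D f \<Longrightarrow> computable_on D (\<lambda>x. int_decode (f x))"
  by (simp add: computable_on_def)

lemma computable_on_nat [computable_intros]:
  assumes "computable_on D f"
  shows "computable_on D (\<lambda>x. nat (f x))"
proof -
  have "nat i = (if even (encode i) then encode i div 2 else 0)" for i
    by (simp add: int_encode_if)
  then show ?thesis by (simp only:) (intro computable_intros assms)
qed

lemma computable_on_nat_uminus [computable_intros]:
  assumes "computable_on D f"
  shows "computable_on D (\<lambda>x. nat (- f x))"
proof -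
  have "nat (- i) = (if even (encode i) then 0 else Suc (encode i div 2))" for i
    by (auto simp: int_encode_if)
  then show ?thesis by (simp only:) (intro computable_intros assms)
qed

lemma computable_on_int_diff:
  fixes f g :: "'a::encodable \<Rightarrow> nat"
  assumes "computable_on D f" "computable_on D g"
  shows "computable_on D (\<lambda>x. int (f x) - int (g x))"
proof (rule computable_on_if_encode)
  have "encode (int m - int n) = (if n \<le> m then 2 * (m - n) else Suc (2 * (n - m - 1)))" for m n
    by (auto simp: int_encode_if nat_diff_distrib')
  then show "computable_on D (\<lambda>x. encode (int (f x) - int (g x)))"
    by (simp only:) (intro computable_intros assms)
qed

lemma computable_on_int_minus [computable_intros]:
  fixes f g :: "'a::encodable \<Rightarrow> int"
  assumes "computable_on D f" "computable_on D g"
  shows "computable_on D (\<lambda>x. f x - g x)"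
proof -
  have "computable_on D (\<lambda>x. int (nat (f x) + nat (- g x)) - int (nat (- f x) + nat (g x)))"
    by (intro computable_on_int_diff computable_intros assms)
  moreover have "int (nat i + nat (- j)) - int (nat (- i) + nat j) = i - j" for i j by simp
  ultimately show ?thesis by (simp only:)
qed

lemma computable_on_int_mult [computable_intros]:
  fixes f g :: "'a::encodable \<Rightarrow> int"
  assumes "computable_on D f" "computable_on D g"
  shows "computable_on D (\<lambda>x. f x * g x)"
proof -
  have "i * j =
      int (nat i * nat j + nat (- i) * nat (- j)) - int (nat i * nat (- j) + nat (- i) * nat j)"
    for i j
    by (cases "0 \<le> i"; cases "0 \<le> j") simp_all
  then show ?thesis by (simp only:) (intro computable_on_int_diff computable_intros assms)
qed

lemma computable_on_nat_abs [computable_intros]: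
  assumes "computable_on D f"
  shows "computable_on D (\<lambda>x. nat \<bar>f x\<bar>)"
proof -
  have "nat \<bar>i\<bar> = nat i + nat (- i)" for i by simp
  then show ?thesis by (simp only:) (intro computable_intros assms)
qed


subsection \<open>Comparison of coded rationals\<close>

text \<open>\<open>Fract a 0 = 0\<close>, so \<open>nat_to_rat_surj\<close> also accepts codes with denominator \<open>0\<close>.\<close>

definition rat_numerator :: "nat \<Rightarrow> int" where
  "rat_numerator q =
    (if int_decode (snd (prod_decode q)) = 0 then 0 else int_decode (fst (prod_decode q)))"

definition rat_denominator :: "nat \<Rightarrow> int" where
  "rat_denominator q =
    (if int_decode (snd (prod_decode q)) = 0 then 1 else int_decode (snd (prod_decode q)))"

lemma rat_denominator_nonzero [simp]: "rat_denominator q \<noteq> 0"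
  by (simp add: rat_denominator_def)

lemma of_rat_nat_to_rat_surj:
  "of_rat (nat_to_rat_surj q) = (of_int (rat_numerator q) / of_int (rat_denominator q) :: real)"
  by (simp add: nat_to_rat_surj_def rat_numerator_def rat_denominator_def of_rat_rat
      rat_number_collapse split: prod.split)

lemma computable_on_rat_numerator [computable_intros]:
  "computable_on D f \<Longrightarrow> computable_on D (\<lambda>x. rat_numerator (f x))"
  unfolding rat_numerator_def by (intro computable_intros)

lemma computable_on_rat_denominator [computable_intros]:
  "computable_on D f \<Longrightarrow> computable_on D (\<lambda>x. rat_denominator (f x))"
  unfolding rat_denominator_def by (intro computable_intros)

abbreviation real_of_code :: "nat \<Rightarrow> real" where
  "real_of_code q \<equiv> of_rat (nat_to_rat_surj q)"

lemma less_dist_real_of_code_iff: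
  "2 / 2 ^ k < \<bar>real_of_code q - real_of_code r\<bar> \<longleftrightarrow>
    2 * nat \<bar>rat_denominator q * rat_denominator r\<bar> <
      2 ^ k * nat \<bar>rat_numerator q * rat_denominator r - rat_numerator r * rat_denominator q\<bar>"
  (is "_ \<longleftrightarrow> 2 * nat \<bar>?D\<bar> < 2 ^ k * nat \<bar>?N\<bar>")
proof -
  have "real_of_code q - real_of_code r = of_int ?N / of_int ?D"
    by (simp add: of_rat_nat_to_rat_surj field_simps)
  then have "2 / 2 ^ k < \<bar>real_of_code q - real_of_code r\<bar> \<longleftrightarrow>
      2 * real_of_int \<bar>?D\<bar> < 2 ^ k * real_of_int \<bar>?N\<bar>"
    by (simp add: abs_divide pos_less_divide_eq divide_less_eq mult.commute)
  also have "\<dots> \<longleftrightarrow> real (2 * nat \<bar>?D\<bar>) < real (2 ^ k * nat \<bar>?N\<bar>)"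
    by simp
  finally show ?thesis unfolding of_nat_less_iff .
qed

lemma computable_on_less_dist_real_of_code [computable_intros]:
  assumes "computable_on D f" "computable_on D g" "computable_on D k"
  shows "computable_on D (\<lambda>x. 2 / 2 ^ k x < \<bar>real_of_code (f x) - real_of_code (g x)\<bar>)"
  unfolding less_dist_real_of_code_iff by (intro computable_intros assms)


subsection \<open>Inequality of computable reals\<close>

definition computable_real_on :: "'a::encodable set \<Rightarrow> ('a \<Rightarrow> real) \<Rightarrow> bool" where
  "computable_real_on D f \<longleftrightarrow> (\<exists>q :: nat \<times> 'a \<Rightarrow> nat. computable_on (UNIV \<times> D) q \<and>
    (\<forall>x\<in>D. \<forall>k. \<bar>real_of_code (q (k, x)) - f x\<bar> \<le> 1 / 2 ^ k))"

lemma neq_iff_approximations_apart: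
  fixes x y :: real
  assumes a: "\<And>k. \<bar>a k - x\<bar> \<le> 1 / 2 ^ k" and b: "\<And>k. \<bar>b k - y\<bar> \<le> 1 / 2 ^ k"
  shows "x \<noteq> y \<longleftrightarrow> (\<exists>k. 2 / 2 ^ k < \<bar>a k - b k\<bar>)"
proof
  assume "x \<noteq> y"
  then obtain k where "(1 / 2) ^ k < \<bar>x - y\<bar> / 4"
    using real_arch_pow_inv[of "\<bar>x - y\<bar> / 4" "1 / 2"] by auto
  then have "4 * (1 / 2 ^ k) < \<bar>x - y\<bar>" by (simp add: power_one_over)
  then have "2 * (1 / 2 ^ k) < \<bar>a k - b k\<bar>" using a[of k] b[of k] by linarith
  then show "\<exists>k. 2 / 2 ^ k < \<bar>a k - b k\<bar>" by auto
next
  assume "\<exists>k. 2 / 2 ^ k < \<bar>a k - b k\<bar>"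
  then obtain k where "2 * (1 / 2 ^ k) < \<bar>a k - b k\<bar>" by auto
  then show "x \<noteq> y" using a[of k] b[of k] by linarith
qed

lemma semidecidable_on_neq:
  assumes "computable_real_on D f" "computable_real_on D g"
  shows "semidecidable_on D (\<lambda>x. f x \<noteq> g x)"
proof -
  obtain q where q: "computable_on (UNIV \<times> D) q"
    "\<And>x k. x \<in> D \<Longrightarrow> \<bar>real_of_code (q (k, x)) - f x\<bar> \<le> 1 / 2 ^ k"
    using assms(1) unfolding computable_real_on_def by blast
  obtain r where r: "computable_on (UNIV \<times> D) r"
    "\<And>x k. x \<in> D \<Longrightarrow> \<bar>real_of_code (r (k, x)) - g x\<bar> \<le> 1 / 2 ^ k"
    using assms(2) unfolding computable_real_on_def by blast
  define apart where "apart p \<longleftrightarrow> 2 / 2 ^ fst p < \<bar>real_of_code (q p) - real_of_code (r p)\<bar>" for p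
  have "computable_on (UNIV \<times> D) apart"
    unfolding apart_def by (intro computable_intros q(1) r(1))
  moreover have "f x \<noteq> g x \<longleftrightarrow> (\<exists>k. apart (k, x))" if "x \<in> D" for x
    unfolding apart_def fst_conv
    by (rule neq_iff_approximations_apart[OF q(2)[OF that] r(2)[OF that]])
  ultimately show ?thesis unfolding semidecidable_on_def by blast
qed


section \<open>Weighings\<close>

lemma weight_eq_iff_equivalent:
  assumes "HP L W" "EP L W" "theory_of L T" "theory_of L U"
  shows "W T = W U \<longleftrightarrow> equivalent L T U"
proof
  show "W T = W U \<Longrightarrow> equivalent L T U" using assms(2-4) unfolding EP_def by blast
next
  assume "equivalent L T U"
  then have "\<not> W U > W T" "\<not> W T > W U"
    using assms(1,3,4) unfolding HP_def equivalent_def by blast+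
  then show "W T = W U" by simp
qed

lemma weight_singleton_eq_weight_empty_iff:
  assumes "HP L W" "EP L W" "\<psi> \<in> sentences L"
  shows "W {\<psi>} = W {} \<longleftrightarrow> derives L {} \<psi>"
proof -
  have "W {\<psi>} = W {} \<longleftrightarrow> equivalent L {\<psi>} {}"
    using assms by (intro weight_eq_iff_equivalent) (simp_all add: theory_of_def)
  then show ?thesis by (simp add: equivalent_def proves_def)
qed

lemma computable_on_singleton_index: "computable_on D (\<lambda>\<psi>. set_encode (fm_code ` {\<psi>}))"
proof -
  have "set_encode (fm_code ` {\<psi>}) = 2 ^ encode \<psi>" for \<psi>
    by (simp add: encode_fm_def set_encode_def)
  then show ?thesis by (simp only:) (intro computable_intros)
qed

lemma computable_real_on_weighing:
  assumes "computable_weighing L W"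
    and finite_theory: "\<And>x. x \<in> D \<Longrightarrow> theory_of L (T x)" "\<And>x. x \<in> D \<Longrightarrow> finite (T x)"
    and index: "computable_on D (\<lambda>x. set_encode (fm_code ` T x))"
  shows "computable_real_on D (\<lambda>x. W (T x))"
proof -
  obtain e where e: "\<And>T k. theory_of L T \<Longrightarrow> finite T \<Longrightarrow>
      \<exists>q. eval e [set_encode (fm_code ` T), k] q \<and> \<bar>real_of_code q - W T\<bar> \<le> 1 / 2 ^ k"
    using assms(1) unfolding computable_weighing_def by blast
  have "\<forall>p\<in>UNIV \<times> D. \<exists>q. eval e [set_encode (fm_code ` T (snd p)), fst p] q \<and>
      \<bar>real_of_code q - W (T (snd p))\<bar> \<le> 1 / 2 ^ fst p"
    using finite_theory by (auto intro!: e)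
  then obtain q where q: "\<And>p. p \<in> UNIV \<times> D \<Longrightarrow> eval e [set_encode (fm_code ` T (snd p)), fst p] (q p)"
    and approx: "\<And>p. p \<in> UNIV \<times> D \<Longrightarrow> \<bar>real_of_code (q p) - W (T (snd p))\<bar> \<le> 1 / 2 ^ fst p"
    by (metis (no_types, lifting))
  obtain index_program where index_program: "\<And>p :: nat \<times> 'a. p \<in> UNIV \<times> D \<Longrightarrow>
      eval index_program [encode p] (set_encode (fm_code ` T (snd p)))"
    using computable_on_Times_snd[OF index, of "UNIV :: nat set"]
    unfolding computable_on_def encode_nat_def by blast
  obtain fst_program where fst_program: "\<And>p :: nat \<times> 'a. eval fst_program [encode p] (fst p)"
    using computable_on_fst[OF computable_on_ident, of "UNIV :: (nat \<times> 'a) set"]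
    unfolding computable_on_def by auto
  have "computable_on (UNIV \<times> D) q"
    using eval_Comp2[OF index_program fst_program q]
    by (intro computable_onI[of _ "Comp e [index_program, fst_program]"]) simp
  then show ?thesis
    using approx unfolding computable_real_on_def by (intro exI[of _ q]) auto
qed

theorem theoremI3p9:
  fixes L :: language and W :: "fm set \<Rightarrow> real"
  assumes "effectively_presented L"
    and "\<not> decidable_logic L"
    and "HP L W"
    and "EP L W"
  shows "\<not> computable_weighing L W"
proof
  assume W: "computable_weighing L W"
  have "computable_real_on (sentences L) (\<lambda>\<psi>. W {\<psi>})"
    by (intro computable_real_on_weighing[OF W] computable_on_singleton_index)
      (simp_all add: theory_of_def)
  moreover have "computable_real_on (sentences L) (\<lambda>\<psi>. W {})"
    by (intro computable_real_on_weighing[OF W] computable_on_const)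
      (simp_all add: theory_of_def)
  ultimately have "semidecidable_on (sentences L) (\<lambda>\<psi>. W {\<psi>} \<noteq> W {})"
    by (rule semidecidable_on_neq)
  then have "semidecidable_on (sentences L) (\<lambda>\<psi>. \<not> derives L {} \<psi>)"
    by (simp add: weight_singleton_eq_weight_empty_iff[OF assms(3,4)] cong: semidecidable_on_cong)
  moreover have "semidecidable_on (sentences L) (derives L {})"
    by (rule semidecidable_on_unary[OF semidecidable_derives[OF assms(1)] computable_on_ident])
  ultimately have "computable_on (sentences L) (derives L {})"
    by (intro Post_computable_on)
  then have "decidable_logic L"
    by (simp add: decidable_logic_def encode_fm_def flip: decidable_on_iff_computable_on)
  with assms(2) show False ..
qed

end
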